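(* Let $R$ be an elementary divisor domain and $W\in R$ a nonzero element. There exists an autoequivalence $F$ of the category $\mathrm{zmf}(R,W)$ such that: 1. $F$ is isomorphic to the identity functor $\mathrm{id}_{\mathrm{zmf}(R,W)}$. 2. For any matrix factorization $a=(R^{\rho|\rho},D)$ of $W$ with $D=\begin{pmatrix}0&v\\ u&0\end{pmatrix}$, we have $$F(a)=e_{d_1(v)}\oplus\cdots\oplus e_{d_\rho(v)},$$ where $d_1(v),\ldots,d_\rho(v)\in R$ are representatives for the invariant factors of $v$, i.e. $d_i(v)\in \mathbf{d}_i(v)$ for all $i\in\{1,\ldots,\rho\}$.
   Context: An integral domain $R$ is an elementary divisor domain if for any $a,b,c\in R$ there exist $p,q,x,y\in R$ such that $pxa+pyb+qyc$ is a greatest common divisor of $a,b,c$ (equivalently, every matrix over $R$ admits a Smith normal form). A (finite rank) matrix factorization of $W\ne0$ over $R$ is a pair $(M,D)$ with $M=M^0\oplus M^1$ a free $\mathbb{Z}/2$-graded $R$-module of finite rank and $D$ an odd endomorphism with $D^2=W\,\mathrm{id}_M$. Choosing homogeneous bases, one identifies $M$ with $R^{\rho|\rho}$ (both homogeneous components equal to $R^{\oplus\rho}$) and $D=\begin{pmatrix}0&v\\ u&0\end{pmatrix}$ with $u,v$ square matrices of size $\rho$ over $R$ satisfying $uv=vu=W I_\rho$; all matrix factorizations are taken in this form. The category $\mathrm{zmf}(R,W)$ has matrix factorizations as objects; morphisms $(M_1,D_1)\to(M_2,D_2)$ are even $R$-linear maps $f$ with $D_2f=fD_1$. For a divisor $v$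 of $W$, $e_v=(R^{1|1},D_v)$ with $D_v=\begin{pmatrix}0&v\\ W/v&0\end{pmatrix}$ is the elementary matrix factorization associated with $v$. Invariant factors: for a square matrix $A$ over $R$ and $k\ge1$, $\boldsymbol{\delta}_k(A)$ is the class, up to multiplication by units, of the greatest common divisor of all $k\times k$ minors of $A$, and $\boldsymbol{\delta}_0(A)=(1)$. For $1\le k\le\mathrm{rk}\,A$, the $k$-th invariant factor is $\mathbf{d}_k(A)=\boldsymbol{\delta}_k(A)/\boldsymbol{\delta}_{k-1}(A)$, a class of elements of $R$ up to units. Since $W\ne 0$, the matrix $v$ above has rank $\rho$. *)

theory Defs
  imports "Jordan_Normal_Form.Determinant" "Jordan_Normal_Form.DL_Submatrix"
begin

section \<open>Elementary divisor domains\<close>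

definition (in comm_semiring_1) is_gcd :: "'a set \<Rightarrow> 'a \<Rightarrow> bool" where
  "is_gcd S g \<longleftrightarrow> (\<forall>a\<in>S. g dvd a) \<and> (\<forall>h. (\<forall>a\<in>S. h dvd a) \<longrightarrow> h dvd g)"

class elementary_divisor_domain = idom +
  assumes elementary_divisor: "\<exists>p q x y. is_gcd {a, b, c} (p * x * a + p * y * b + q * y * c)"

section \<open>Invariant factors\<close>

definition minors :: "nat \<Rightarrow> 'a::comm_ring_1 mat \<Rightarrow> 'a set" where
  "minors k A = {det (submatrix A I J) | I J.
     I \<subseteq> {..<dim_row A} \<and> J \<subseteq> {..<dim_col A} \<and> card I = k \<and> card J = k}"

text \<open>A class of ring elements up to multiplication by units is represented by the set of its
  members.\<close>

definition determinantal_divisor :: "nat \<Rightarrow> 'a::idom mat \<Rightarrow> 'a set" where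
  "determinantal_divisor k A = (if k = 0 then {g. g dvd 1} else {g. is_gcd (minors k A) g})"

text \<open>This is the quotient of the \<open>k\<close>-th class by the \<open>(k - 1)\<close>-st one; it is only meaningful for
  \<open>1 \<le> k \<le> rk A\<close>, where the elements of both classes are nonzero.\<close>

definition invariant_factor :: "nat \<Rightarrow> 'a::idom mat \<Rightarrow> 'a set" where
  "invariant_factor k A =
     {d. \<exists>g\<in>determinantal_divisor k A. \<exists>h\<in>determinantal_divisor (k - 1) A. g = d * h}"

section \<open>Categories, functors, equivalences\<close>

text \<open>Hom-sets need not be disjoint, so the action of a functor on a morphism takes the source and
  the target as arguments as well.\<close>

record ('o, 'm) cat =
  Ob :: "'o set"
  Hom :: "'o \<Rightarrow> 'o \<Rightarrow> 'm set"
  Idn :: "'o \<Rightarrow> 'm"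
  Comp :: "'m \<Rightarrow> 'm \<Rightarrow> 'm"

record ('o, 'm, 'p, 'n) func =
  omap :: "'o \<Rightarrow> 'p"
  amap :: "'o \<Rightarrow> 'o \<Rightarrow> 'm \<Rightarrow> 'n"

locale category =
  fixes C :: "('o, 'm) cat"
  assumes Idn_in_Hom: "a \<in> Ob C \<Longrightarrow> Idn C a \<in> Hom C a a"
    and Comp_in_Hom: "\<lbrakk>a \<in> Ob C; b \<in> Ob C; c \<in> Ob C; f \<in> Hom C a b; g \<in> Hom C b c\<rbrakk>
      \<Longrightarrow> Comp C g f \<in> Hom C a c"
    and Comp_Idn: "\<lbrakk>a \<in> Ob C; b \<in> Ob C; f \<in> Hom C a b\<rbrakk> \<Longrightarrow> Comp C f (Idn C a) = f"
    and Idn_Comp: "\<lbrakk>a \<in> Ob C; b \<in> Ob C; f \<in> Hom C a b\<rbrakk> \<Longrightarrow> Comp C (Idn C b) f = f"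
    and Comp_assoc: "\<lbrakk>a \<in> Ob C; b \<in> Ob C; c \<in> Ob C; d \<in> Ob C;
      f \<in> Hom C a b; g \<in> Hom C b c; h \<in> Hom C c d\<rbrakk>
      \<Longrightarrow> Comp C (Comp C h g) f = Comp C h (Comp C g f)"

locale functor_between = C: category C + D: category D
  for C :: "('o, 'm) cat" and D :: "('p, 'n) cat" +
  fixes F :: "('o, 'm, 'p, 'n) func"
  assumes omap_in_Ob: "a \<in> Ob C \<Longrightarrow> omap F a \<in> Ob D"
    and amap_in_Hom: "\<lbrakk>a \<in> Ob C; b \<in> Ob C; f \<in> Hom C a b\<rbrakk>
      \<Longrightarrow> amap F a b f \<in> Hom D (omap F a) (omap F b)"
    and amap_Idn: "a \<in> Ob C \<Longrightarrow> amap F a a (Idn C a) = Idn D (omap F a)"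
    and amap_Comp: "\<lbrakk>a \<in> Ob C; b \<in> Ob C; c \<in> Ob C; f \<in> Hom C a b; g \<in> Hom C b c\<rbrakk>
      \<Longrightarrow> amap F a c (Comp C g f) = Comp D (amap F b c g) (amap F a b f)"

definition id_func :: "('o, 'm, 'o, 'm) func" where
  "id_func = \<lparr>omap = (\<lambda>a. a), amap = (\<lambda>a b f. f)\<rparr>"

definition comp_func ::
    "('p, 'n, 'q, 'k) func \<Rightarrow> ('o, 'm, 'p, 'n) func \<Rightarrow> ('o, 'm, 'q, 'k) func" where
  "comp_func G F = \<lparr>omap = (\<lambda>a. omap G (omap F a)),
     amap = (\<lambda>a b f. amap G (omap F a) (omap F b) (amap F a b f))\<rparr>"

definition is_iso :: "('o, 'm) cat \<Rightarrow> 'o \<Rightarrow> 'o \<Rightarrow> 'm \<Rightarrow> bool" where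
  "is_iso C a b f \<longleftrightarrow> f \<in> Hom C a b \<and>
     (\<exists>g\<in>Hom C b a. Comp C g f = Idn C a \<and> Comp C f g = Idn C b)"

definition natural_iso :: "('o, 'm) cat \<Rightarrow> ('p, 'n) cat \<Rightarrow>
    ('o, 'm, 'p, 'n) func \<Rightarrow> ('o, 'm, 'p, 'n) func \<Rightarrow> ('o \<Rightarrow> 'n) \<Rightarrow> bool" where
  "natural_iso C D F G \<eta> \<longleftrightarrow>
     (\<forall>a\<in>Ob C. is_iso D (omap F a) (omap G a) (\<eta> a)) \<and>
     (\<forall>a\<in>Ob C. \<forall>b\<in>Ob C. \<forall>f\<in>Hom C a b.
        Comp D (\<eta> b) (amap F a b f) = Comp D (amap G a b f) (\<eta> a))"

definition func_isomorphic :: "('o, 'm) cat \<Rightarrow> ('p, 'n) cat \<Rightarrow>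
    ('o, 'm, 'p, 'n) func \<Rightarrow> ('o, 'm, 'p, 'n) func \<Rightarrow> bool" where
  "func_isomorphic C D F G \<longleftrightarrow>
     functor_between C D F \<and> functor_between C D G \<and> (\<exists>\<eta>. natural_iso C D F G \<eta>)"

definition equivalence_of_categories ::
    "('o, 'm) cat \<Rightarrow> ('p, 'n) cat \<Rightarrow> ('o, 'm, 'p, 'n) func \<Rightarrow> bool" where
  "equivalence_of_categories C D F \<longleftrightarrow>
     functor_between C D F \<and>
     (\<exists>G. functor_between D C G \<and>
        func_isomorphic C C (comp_func G F) id_func \<and>
        func_isomorphic D D (comp_func F G) id_func)"

abbreviation autoequivalence :: "('o, 'm) cat \<Rightarrow> ('o, 'm, 'o, 'm) func \<Rightarrow> bool" where
  "autoequivalence C \<equiv> equivalence_of_categories C C"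

section \<open>The category of matrix factorizations\<close>

text \<open>A matrix factorization on \<open>R\<^bsup>\<rho>|\<rho>\<^esup>\<close> is the pair of \<open>\<rho>\<close> and the \<open>2\<rho> \<times> 2\<rho>\<close> matrix of \<open>D\<close>.
  The even part of \<open>R\<^bsup>\<rho>|\<rho>\<^esup>\<close> is spanned by the first \<open>\<rho>\<close> basis vectors. The rank \<open>\<rho> = 0\<close> is allowed.\<close>

type_synonym 'a mf = "nat \<times> 'a mat"

definition odd_mat :: "nat \<Rightarrow> 'a::zero mat \<Rightarrow> 'a mat \<Rightarrow> 'a mat" where
  "odd_mat \<rho> u v = four_block_mat (0\<^sub>m \<rho> \<rho>) v u (0\<^sub>m \<rho> \<rho>)"

definition odd_endos :: "nat \<Rightarrow> 'a::zero mat set" where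
  "odd_endos \<rho> = {odd_mat \<rho> u v | u v. u \<in> carrier_mat \<rho> \<rho> \<and> v \<in> carrier_mat \<rho> \<rho>}"

definition even_maps :: "nat \<Rightarrow> nat \<Rightarrow> 'a::zero mat set" where
  "even_maps \<rho>1 \<rho>2 = {four_block_mat f0 (0\<^sub>m \<rho>2 \<rho>1) (0\<^sub>m \<rho>2 \<rho>1) f1 | f0 f1.
     f0 \<in> carrier_mat \<rho>2 \<rho>1 \<and> f1 \<in> carrier_mat \<rho>2 \<rho>1}"

definition zmf :: "'a::idom \<Rightarrow> ('a mf, 'a mat) cat" where
  "zmf W = \<lparr>
     Ob = {(\<rho>, D). D \<in> odd_endos \<rho> \<and> D * D = W \<cdot>\<^sub>m 1\<^sub>m (\<rho> + \<rho>)},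
     Hom = (\<lambda>(\<rho>1, D1) (\<rho>2, D2). {f \<in> even_maps \<rho>1 \<rho>2. D2 * f = f * D1}),
     Idn = (\<lambda>(\<rho>, D). 1\<^sub>m (\<rho> + \<rho>)),
     Comp = (\<lambda>g f. g * f)\<rparr>"

text \<open>The quotient \<open>W / v\<close> is determined by \<open>v dvd W\<close> and \<open>W \<noteq> 0\<close>.\<close>

definition elementary_mf :: "'a::idom \<Rightarrow> 'a \<Rightarrow> 'a mf" where
  "elementary_mf W v = (1, odd_mat 1 (mat 1 1 (\<lambda>_. THE w. W = v * w)) (mat 1 1 (\<lambda>_. v)))"

fun mf_v :: "'a mf \<Rightarrow> 'a mat" where
  "mf_v (\<rho>, D) = (case split_block D \<rho> \<rho> of (_, v, _, _) \<Rightarrow> v)"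

fun mf_u :: "'a mf \<Rightarrow> 'a mat" where
  "mf_u (\<rho>, D) = (case split_block D \<rho> \<rho> of (_, _, u, _) \<Rightarrow> u)"

text \<open>The basis of the even (odd) part of a direct sum is the concatenation of the bases of the even
  (odd) parts of the summands.\<close>

definition direct_sum_mf :: "'a::zero mf list \<Rightarrow> 'a mf" where
  "direct_sum_mf as = (let \<rho> = sum_list (map fst as)
     in (\<rho>, odd_mat \<rho> (diag_block_mat (map mf_u as)) (diag_block_mat (map mf_v as))))"

text \<open>A choice of representatives \<open>d v i\<close> of the \<open>i\<close>-th invariant factor, for the upper right block
  \<open>v\<close> of every matrix factorization of \<open>W\<close> and \<open>1 \<le> i \<le> \<rho>\<close>.\<close>

definition invariant_factor_reps :: "'a::idom \<Rightarrow> ('a mat \<Rightarrow> nat \<Rightarrow> 'a) \<Rightarrow> bool" where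
  "invariant_factor_reps W d \<longleftrightarrow>
     (\<forall>\<rho>. \<forall>u\<in>carrier_mat \<rho> \<rho>. \<forall>v\<in>carrier_mat \<rho> \<rho>. (\<rho>, odd_mat \<rho> u v) \<in> Ob (zmf W) \<longrightarrow>
        (\<forall>i\<in>{1..\<rho>}. d v i \<in> invariant_factor i v))"

end

theory Submission
  imports Defs
begin

text \<open>Over an elementary divisor domain every square matrix \<open>A\<close> has vectors \<open>p, x\<close> such that \<open>p A x\<close> is
  a gcd of all entries of \<open>A\<close>. If \<open>A \<noteq> 0\<close>, these vectors are unimodular, hence can be completed to
  invertible matrices, and \<open>A\<close> is equivalent to a matrix with the gcd in the corner; clearing its row
  and column and iterating yields a Smith normal form. Since determinantal divisors only depend on the
  equivalence class, the diagonal entries of the normal form of \<open>v\<close> are the invariant factors, up to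
  units which can be absorbed. From \<open>P v Q = diag(d\<^sub>1, \<dots>, d\<^sub>\<rho>)\<close> and \<open>v u = W\<close> it follows that
  \<open>Q\<^sup>-\<^sup>1 u P\<^sup>-\<^sup>1 = diag(W / d\<^sub>1, \<dots>, W / d\<^sub>\<rho>)\<close>, so \<open>(P, Q\<^sup>-\<^sup>1)\<close> is an isomorphism of the given matrix
  factorization with the direct sum of the elementary ones. Transporting the identity functor along
  these isomorphisms gives \<open>F\<close>.\<close>

section \<open>Greatest common divisors\<close>

text \<open>The defining condition for the triple with third entry zero yields a gcd of the first
  two entries that is a linear combination of them, so the domain is a Bezout domain.\<close>

lemma bezout:
  fixes a b :: "'a::elementary_divisor_domain"
  obtains s t where "s * a + t * b dvd a" "s * a + t * b dvd b"
proof -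
  obtain p q x y where "is_gcd {a, b, 0} (p * x * a + p * y * b + q * y * 0)"
    using elementary_divisor by blast
  then show ?thesis
    by (intro that[of "p * x" "p * y"]) (auto simp: is_gcd_def)
qed

text \<open>A linear combination of the \<open>r j\<close> that divides each of them is
  automatically their gcd. In the induction the combination found so far is paired with the new
  entry, and its coefficients are scaled by the Bezout coefficient \<open>s\<close>.\<close>

lemma bezout_vector:
  fixes r :: "nat \<Rightarrow> 'a::elementary_divisor_domain"
  shows "\<exists>z. \<forall>j<n. (\<Sum>i<n. z i * r i) dvd r j"
proof (induction n)
  case (Suc n)
  then obtain z where z: "\<And>j. j < n \<Longrightarrow> (\<Sum>i<n. z i * r i) dvd r j" by blast
  define c where "c = (\<Sum>i<n. z i * r i)"
  obtain s t where st: "s * c + t * r n dvd c" "s * c + t * r n dvd r n" by (rule bezout)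
  define y where "y = (\<lambda>i. if i = n then t else s * z i)"
  have "(\<Sum>i<n. y i * r i) = s * c"
    unfolding y_def c_def sum_distrib_left by (intro sum.cong) (auto simp: mult.assoc)
  then have "(\<Sum>i<Suc n. y i * r i) = s * c + t * r n" by (simp add: y_def)
  with st z have "\<forall>j<Suc n. (\<Sum>i<Suc n. y i * r i) dvd r j"
    by (metis c_def dvd_trans less_Suc_eq)
  then show ?case by blast
qed simp

text \<open>When a row is added to \<open>A\<close>, the elementary divisor condition is applied to the triple formed by the
  gcd \<open>b\<close> of the old rows, the value \<open>r\<close> of the new row on the old vector \<open>x\<close>, and the gcd \<open>c\<close> of the new
  row restricted to the kernel of the functional \<open>s\<close> with \<open>p A = b s\<close>.\<close>

lemma bilinear_gcd:
  fixes A :: "nat \<Rightarrow> nat \<Rightarrow> 'a::elementary_divisor_domain"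
  shows "\<exists>p x. \<forall>i<m. \<forall>j<n. (\<Sum>k<m. \<Sum>l<n. p k * A k l * x l) dvd A i j"
proof (induction m)
  case (Suc m)
  then obtain p x where px: "\<And>i j. i < m \<Longrightarrow> j < n \<Longrightarrow> (\<Sum>k<m. \<Sum>l<n. p k * A k l * x l) dvd A i j"
    by blast
  define b where "b = (\<Sum>k<m. \<Sum>l<n. p k * A k l * x l)"
  note b = px[folded b_def]
  have "\<exists>q y. \<forall>i\<le>m. \<forall>j<n. (\<Sum>k<m. \<Sum>l<n. q k * A k l * y l) + (\<Sum>l<n. q m * A m l * y l) dvd A i j"
  \<comment> \<open>If the gcd \<open>b\<close> of the old rows is zero, these rows vanish and only
    the new row counts; otherwise \<open>b\<close> can be cancelled.\<close>
  proof (cases "b = 0")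
    case True
    with b have A0: "A i j = 0" if "i < m" "j < n" for i j using that by simp
    obtain z where z: "\<forall>j<n. (\<Sum>l<n. z l * A m l) dvd A m j" using bezout_vector by blast
    have 0: "(\<Sum>k<m. \<Sum>l<n. 1 * A k l * z l) = 0" by (intro sum.neutral ballI) (simp add: A0)
    show ?thesis
    proof (intro exI allI impI)
      fix i j assume "i \<le> m" "j < n"
      then show "(\<Sum>k<m. \<Sum>l<n. (\<lambda>_. 1) k * A k l * z l) + (\<Sum>l<n. (\<lambda>_. 1) m * A m l * z l) dvd A i j"
        using z A0 0 by (cases "i = m") (auto simp: mult.commute[of "z _"])
    qed
  next
    case False
    have swap: "b = (\<Sum>l<n. (\<Sum>k<m. p k * A k l) * x l)"
      unfolding b_def sum_distrib_right by (rule sum.swap)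
    \<comment> \<open>\<open>b\<close> divides every old entry, hence every coordinate of the row
      combination \<open>p A\<close>; the quotients form \<open>s\<close>.\<close>
    have "\<exists>s. \<forall>l. l < n \<longrightarrow> (\<Sum>k<m. p k * A k l) = b * s l"
      by (rule choice) (auto intro!: dvd_sum dvd_mult b simp flip: dvd_def)
    then obtain s where s: "\<And>l. l < n \<Longrightarrow> (\<Sum>k<m. p k * A k l) = b * s l" by blast
    \<comment> \<open>Evaluating \<open>p A = b s\<close> at \<open>x\<close> returns
      \<open>b\<close>, so \<open>s\<close> takes the value 1 on \<open>x\<close>.\<close>
    have "b * (\<Sum>l<n. s l * x l) = b"
      by (subst (2) swap) (simp add: s sum_distrib_left mult.assoc)
    with False have sx: "(\<Sum>l<n. s l * x l) = 1" by simp
    define r where "r = (\<Sum>l<n. A m l * x l)"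
    \<comment> \<open>Subtracting \<open>r * s\<close> makes the new row vanish on \<open>x\<close>;
      the gcd of what remains is its contribution on the kernel of \<open>s\<close>.\<close>
    obtain z where z: "\<And>j. j < n \<Longrightarrow> (\<Sum>l<n. z l * (A m l - r * s l)) dvd A m j - r * s j"
      using bezout_vector[of n "\<lambda>l. A m l - r * s l"] by blast
    define c where "c = (\<Sum>l<n. z l * (A m l - r * s l))"
    define t where "t = (\<Sum>l<n. s l * z l)"
    \<comment> \<open>\<open>y\<close> is the projection of \<open>z\<close> to the kernel of \<open>s\<close> along \<open>x\<close>.\<close>
    define y where "y = (\<lambda>l. z l - t * x l)"
    have sy: "(\<Sum>l<n. s l * y l) = 0"
    proof -
      have "(\<Sum>l<n. s l * y l) = (\<Sum>l<n. s l * z l - t * (s l * x l))"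
        by (simp add: y_def algebra_simps)
      also have "\<dots> = 0" by (simp add: sum_subtractf sx t_def[symmetric] flip: sum_distrib_left)
      finally show ?thesis .
    qed
    have ry: "(\<Sum>l<n. A m l * y l) = c"
    proof -
      have "(\<Sum>l<n. A m l * y l) = (\<Sum>l<n. A m l * z l - t * (A m l * x l))"
        by (simp add: y_def algebra_simps)
      also have "\<dots> = (\<Sum>l<n. A m l * z l) - t * r"
        by (simp add: sum_subtractf r_def flip: sum_distrib_left)
      also have "\<dots> = (\<Sum>l<n. A m l * z l - r * (s l * z l))"
        by (simp add: sum_subtractf t_def mult.commute flip: sum_distrib_left)
      also have "\<dots> = c" by (simp add: c_def algebra_simps)
      finally show ?thesis .
    qed
    obtain P Q X Y where g: "is_gcd {c, r, b} (P * X * c + P * Y * r + Q * Y * b)"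
      using elementary_divisor by blast
    define g where "g = P * X * c + P * Y * r + Q * Y * b"
    have g_dvd: "g dvd c" "g dvd r" "g dvd b" using g by (auto simp: is_gcd_def g_def)
    \<comment> \<open>On \<open>x'\<close> the functional \<open>s\<close> has the value
      \<open>Y\<close> and the new row has the value \<open>X * c + Y * r\<close>; weighting these
      by \<open>Q * b\<close> and \<open>P\<close> gives \<open>g\<close>.\<close>
    define x' where "x' = (\<lambda>l. X * y l + Y * x l)"
    define p' where "p' = (\<lambda>i. if i = m then P else Q * p i)"
    have "(\<Sum>k<m. \<Sum>l<n. p' k * A k l * x' l) = (\<Sum>k<m. \<Sum>l<n. Q * (p k * A k l) * x' l)"
      by (intro sum.cong refl) (auto simp: p'_def mult.assoc)
    also have "\<dots> = (\<Sum>l<n. Q * (\<Sum>k<m. p k * A k l) * x' l)"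
      by (subst sum.swap) (simp add: sum_distrib_left sum_distrib_right)
    also have "\<dots> = (\<Sum>l<n. Q * b * (s l * x' l))"
      by (intro sum.cong refl) (auto simp: s mult.assoc)
    also have "\<dots> = Q * b * (X * (\<Sum>l<n. s l * y l) + Y * (\<Sum>l<n. s l * x l))"
      by (simp add: x'_def algebra_simps sum.distrib sum_distrib_left)
    finally have 1: "(\<Sum>k<m. \<Sum>l<n. p' k * A k l * x' l) = Q * Y * b" by (simp add: sx sy mult_ac)
    have "(\<Sum>l<n. p' m * A m l * x' l) = P * (X * (\<Sum>l<n. A m l * y l) + Y * (\<Sum>l<n. A m l * x l))"
      by (simp add: x'_def p'_def algebra_simps sum.distrib sum_distrib_left)
    also have "\<dots> = P * X * c + P * Y * r" unfolding ry r_def[symmetric] by (simp add: algebra_simps)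
    finally have 2: "(\<Sum>k<m. \<Sum>l<n. p' k * A k l * x' l) + (\<Sum>l<n. p' m * A m l * x' l) = g"
      by (simp add: 1 g_def)
    have "g dvd A i j" if "i \<le> m" "j < n" for i j
    proof (cases "i = m")
      case True
      \<comment> \<open>\<open>c\<close> divides the corrected new row and \<open>r\<close> divides
        the correction, so \<open>g\<close> divides every entry of the new row.\<close>
      have "g dvd (A m j - r * s j) + r * s j"
        using g_dvd dvd_trans[OF _ z[OF that(2), folded c_def]] by (intro dvd_add dvd_mult2) auto
      with True show ?thesis by simp
    next
      case False
      with that have "b dvd A i j" by (intro b) auto
      with g_dvd show ?thesis using dvd_trans by blast
    qed
    then show ?thesis by (intro exI[of _ p'] exI[of _ x']) (simp add: 2)
  qed
  then show ?case by (auto simp: less_Suc_eq_le)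
qed simp

section \<open>Invertible matrices\<close>

lemma index_mult_mat_sum:
  assumes "A \<in> carrier_mat n m" "B \<in> carrier_mat m p" "i < n" "j < p"
  shows "(A * B) $$ (i, j) = (\<Sum>k<m. A $$ (i, k) * B $$ (k, j))"
  using assms by (simp add: scalar_prod_def lessThan_atLeast0)

text \<open>The inverse is a parameter because it reappears explicitly in the isomorphisms of
  factorizations built from \<open>P\<close> and \<open>Q\<close>.\<close>

definition mutually_inverse :: "nat \<Rightarrow> 'a::comm_ring_1 mat \<Rightarrow> 'a mat \<Rightarrow> bool" where
  "mutually_inverse n P P' \<longleftrightarrow>
     P \<in> carrier_mat n n \<and> P' \<in> carrier_mat n n \<and> P * P' = 1\<^sub>m n \<and> P' * P = 1\<^sub>m n"

lemma mutually_inverse_sym: "mutually_inverse n P P' \<Longrightarrow> mutually_inverse n P' P"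
  by (auto simp: mutually_inverse_def)

lemma mutually_inverse_one: "mutually_inverse n (1\<^sub>m n) (1\<^sub>m n)"
  by (auto simp: mutually_inverse_def)

lemma mutually_inverse_transpose:
  "mutually_inverse n P P' \<Longrightarrow> mutually_inverse n (transpose_mat P) (transpose_mat P')"
  unfolding mutually_inverse_def
  using transpose_mult[of P n n P' n, symmetric] transpose_mult[of P' n n P n, symmetric]
  by (simp del: transpose_mult)

lemma mutually_inverse_cancel:
  assumes "mutually_inverse n P P'" "A \<in> carrier_mat n m"
  shows "P * (P' * A) = A"
  using assms assoc_mult_mat[of P n n P' n A m] by (simp add: mutually_inverse_def)

lemma mutually_inverse_mult:
  assumes P: "mutually_inverse n P P'" and Q: "mutually_inverse n Q Q'"
  shows "mutually_inverse n (P * Q) (Q' * P')"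
proof -
  have c: "P \<in> carrier_mat n n" "P' \<in> carrier_mat n n" "Q \<in> carrier_mat n n" "Q' \<in> carrier_mat n n"
    using P Q by (auto simp: mutually_inverse_def)
  then have "P * Q * (Q' * P') = P * (Q * (Q' * P'))" "Q' * P' * (P * Q) = Q' * (P' * (P * Q))"
    by (simp_all add: assoc_mult_mat[of _ n n _ n _ n])
  with c P Q mutually_inverse_cancel[OF Q c(2)]
    mutually_inverse_cancel[OF mutually_inverse_sym[OF P] c(3)]
  show ?thesis by (auto simp: mutually_inverse_def)
qed

lemma mutually_inverse_block:
  assumes "mutually_inverse m P P'" "mutually_inverse n Q Q'"
  shows "mutually_inverse (m + n) (four_block_mat P (0\<^sub>m m n) (0\<^sub>m n m) Q)
    (four_block_mat P' (0\<^sub>m m n) (0\<^sub>m n m) Q')"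
  using assms unfolding mutually_inverse_def
  by (auto simp: mult_four_block_mat[of _ m m _ n _ n _ _ m _ n])

lemma mutually_inverse_unipotent_lower:
  assumes "C \<in> carrier_mat n m"
  shows "mutually_inverse (m + n) (four_block_mat (1\<^sub>m m) (0\<^sub>m m n) C (1\<^sub>m n))
    (four_block_mat (1\<^sub>m m) (0\<^sub>m m n) (- C) (1\<^sub>m n))"
  using assms unfolding mutually_inverse_def
  by (auto simp: mult_four_block_mat[of _ m m _ n _ n _ _ m _ n] intro!: eq_matI)

lemma mutually_inverse_unipotent_upper:
  assumes "B \<in> carrier_mat m n"
  shows "mutually_inverse (m + n) (four_block_mat (1\<^sub>m m) B (0\<^sub>m n m) (1\<^sub>m n))
    (four_block_mat (1\<^sub>m m) (- B) (0\<^sub>m n m) (1\<^sub>m n))"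
  using assms unfolding mutually_inverse_def
  by (auto simp: mult_four_block_mat[of _ m m _ n _ n _ _ m _ n] intro!: eq_matI)

text \<open>The \<open>2 \<times> 2\<close> matrix with rows \<open>(a, b)\<close> and \<open>(c, d)\<close> acting on the coordinates \<open>0\<close> and \<open>k\<close>.\<close>

definition plane_mat :: "nat \<Rightarrow> nat \<Rightarrow> 'a::comm_ring_1 \<Rightarrow> 'a \<Rightarrow> 'a \<Rightarrow> 'a \<Rightarrow> 'a mat" where
  "plane_mat n k a b c d = mat n n (\<lambda>(i, j).
     if i = 0 then (if j = 0 then a else 0) + (if j = k then b else 0)
     else if i = k then (if j = 0 then c else 0) + (if j = k then d else 0)
     else if i = j then 1 else 0)"

lemma plane_mat_carrier [simp]: "plane_mat n k a b c d \<in> carrier_mat n n"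
  by (simp add: plane_mat_def)

lemma plane_mat_mult:
  assumes "A \<in> carrier_mat n m" "0 < k" "k < n" "i < n" "j < m"
  shows "(plane_mat n k a b c d * A) $$ (i, j) =
    (if i = 0 then a * A $$ (0, j) + b * A $$ (k, j)
     else if i = k then c * A $$ (0, j) + d * A $$ (k, j) else A $$ (i, j))"
proof -
  have "(plane_mat n k a b c d * A) $$ (i, j) = (\<Sum>l<n. plane_mat n k a b c d $$ (i, l) * A $$ (l, j))"
    using assms by (intro index_mult_mat_sum) auto
  \<comment> \<open>Rows \<open>0\<close> and \<open>k\<close> have at most two nonzero entries,
    each written as a separate summand supported at one index, so that the sum over \<open>l\<close>
    collapses.\<close>
  also have "\<dots> = (\<Sum>l<n. if i = 0 then (if l = 0 then a * A $$ (0, j) else 0) + (if l = k then b * A $$ (k, j) else 0)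
     else if i = k then (if l = 0 then c * A $$ (0, j) else 0) + (if l = k then d * A $$ (k, j) else 0)
     else if i = l then A $$ (i, j) else 0)"
    using assms by (intro sum.cong refl) (auto simp: plane_mat_def)
  also have "\<dots> = (if i = 0 then a * A $$ (0, j) + b * A $$ (k, j)
     else if i = k then c * A $$ (0, j) + d * A $$ (k, j) else A $$ (i, j))"
    using assms by (simp add: sum.distrib)
  finally show ?thesis .
qed

lemma mutually_inverse_plane_mat:
  assumes "0 < k" "k < n" "a * d - b * c = 1"
  shows "mutually_inverse n (plane_mat n k a b c d) (plane_mat n k d (- b) (- c) a)"
proof -
  \<comment> \<open>Stated for all entries of determinant one, since the product in the other order
    is the instance with the matrix replaced by its adjugate.\<close>
  have 1: "plane_mat n k a b c d * plane_mat n k d (- b) (- c) a = 1\<^sub>m n"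
    if "a * d - b * c = 1" for a b c d :: 'a
  proof (rule eq_matI)
    fix i j assume "i < dim_row (1\<^sub>m n :: 'a mat)" "j < dim_col (1\<^sub>m n :: 'a mat)"
    then have ij: "i < n" "j < n" by auto
    show "(plane_mat n k a b c d * plane_mat n k d (- b) (- c) a) $$ (i, j) = 1\<^sub>m n $$ (i, j)"
      unfolding plane_mat_mult[OF plane_mat_carrier assms(1,2) ij]
      using ij assms(1,2) that by (auto simp: plane_mat_def algebra_simps)
  qed (simp_all add: plane_mat_def)
  from 1[OF assms(3)] 1[of d a "- b" "- c"] assms(3) show ?thesis
    by (simp add: mutually_inverse_def mult.commute)
qed

section \<open>Completion of unimodular vectors to invertible matrices\<close>

lemma bezout_complement:
  fixes a b :: "'a::elementary_divisor_domain"
  obtains s t p q where "s * q - t * p = 1" "p * a + q * b = 0"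
\<comment> \<open>A pair of zeros has gcd zero, which cannot be cancelled; there the identity matrix
  serves.\<close>
proof (cases "a = 0 \<and> b = 0")
  case True
  then show ?thesis by (intro that[of 1 1 0 0]) auto
next
  case False
  obtain s t where st: "s * a + t * b dvd a" "s * a + t * b dvd b" by (rule bezout)
  define g where "g = s * a + t * b"
  from st[folded g_def] obtain a' b' where ab: "a = g * a'" "b = g * b'" by (elim dvdE)
  with False have "g \<noteq> 0" by auto
  have "g * (s * a' + t * b') = s * (g * a') + t * (g * b')" by (simp add: algebra_simps)
  also have "\<dots> = g * 1" unfolding ab[symmetric] by (simp add: g_def)
  finally have "g * (s * a' + t * b') = g * 1" .
  with \<open>g \<noteq> 0\<close> have "s * a' + t * b' = 1" by (metis mult_left_cancel)
  \<comment> \<open>The second row is \<open>(- b', a')\<close>, which annihilates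
    \<open>(g * a', g * b')\<close>; the determinant condition is the Bezout relation for the
    cofactors.\<close>
  then show ?thesis by (intro that[of s a' t "- b'"]) (auto simp: ab)
qed

text \<open>Coordinates \<open>1, 2, ...\<close> are killed in turn against the pivot in coordinate
  \<open>0\<close>; each plane matrix leaves the coordinates already killed untouched.\<close>

lemma column_reduction:
  fixes w :: "'a::elementary_divisor_domain mat"
  assumes "w \<in> carrier_mat n 1"
  shows "\<exists>U U'. mutually_inverse n U U' \<and> (\<forall>i\<in>{0<..<n}. (U * w) $$ (i, 0) = 0)"
proof -
  have "\<exists>U U'. mutually_inverse n U U' \<and> (\<forall>i\<in>{0<..<k}. (U * w) $$ (i, 0) = 0)" if "k \<le> n" for k
    using that
  proof (induction k)
    case 0
    then show ?case using mutually_inverse_one by fastforce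
  next
    case (Suc k)
    then obtain U U' where U: "mutually_inverse n U U'" "\<forall>i\<in>{0<..<k}. (U * w) $$ (i, 0) = 0"
      by auto
    show ?case
    proof (cases "k = 0")
      case True
      with U show ?thesis by auto
    next
      case False
      obtain s t p q where pq: "s * q - t * p = 1" "p * (U * w) $$ (0, 0) + q * (U * w) $$ (k, 0) = 0"
        by (rule bezout_complement)
      let ?T = "plane_mat n k s t p q"
      have T: "mutually_inverse n ?T (plane_mat n k q (- t) (- p) s)"
        using False Suc.prems pq by (intro mutually_inverse_plane_mat) auto
      have c: "U \<in> carrier_mat n n" using U by (auto simp: mutually_inverse_def)
      have "(?T * U * w) $$ (i, 0) = 0" if "i \<in> {0<..<Suc k}" for i
      proof -
        have "?T * U * w = ?T * (U * w)" using c assms by (simp add: assoc_mult_mat[of _ n n _ n _ 1])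
        then have "(?T * U * w) $$ (i, 0) = (if i = k then p * (U * w) $$ (0, 0) + q * (U * w) $$ (k, 0)
            else (U * w) $$ (i, 0))"
          using that False Suc.prems c assms plane_mat_mult[of "U * w" n 1 k i 0] by auto
        with that U pq show ?thesis by (auto simp: less_Suc_eq)
      qed
      with mutually_inverse_mult[OF T U(1)] show ?thesis by blast
    qed
  qed
  then show ?thesis by blast
qed

text \<open>If \<open>U\<close> reduces \<open>w\<close> to \<open>g\<close> times the first unit
  vector, then \<open>w\<close> is \<open>g\<close> times the first column of \<open>U'\<close>.
  Unimodularity makes \<open>g\<close> a unit, so rescaling that column by \<open>g\<close> keeps
  the matrix invertible.\<close>

lemma unimodular_completion:
  fixes w :: "nat \<Rightarrow> 'a::elementary_divisor_domain"
  assumes "0 < n" and unimod: "(\<Sum>i<n. z i * w i) = 1"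
  shows "\<exists>U U'. mutually_inverse n U U' \<and> (\<forall>i<n. U $$ (i, 0) = w i)"
proof -
  define v where "v = mat n 1 (\<lambda>(i, _). w i)"
  have v: "v \<in> carrier_mat n 1" by (simp add: v_def)
  obtain U U' where U: "mutually_inverse n U U'" "\<forall>i\<in>{0<..<n}. (U * v) $$ (i, 0) = 0"
    using column_reduction[OF v] by blast
  have c: "U \<in> carrier_mat n n" "U' \<in> carrier_mat n n" using U by (auto simp: mutually_inverse_def)
  define g where "g = (U * v) $$ (0, 0)"
  have wi: "w i = U' $$ (i, 0) * g" if "i < n" for i
  proof -
    have "w i = (U' * (U * v)) $$ (i, 0)"
      using mutually_inverse_cancel[OF mutually_inverse_sym[OF U(1)] v] that by (simp add: v_def)
    also have "\<dots> = (\<Sum>k<n. U' $$ (i, k) * (U * v) $$ (k, 0))"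
      by (rule index_mult_mat_sum[of _ n n _ 1]) (use that c v in auto)
    also have "\<dots> = (\<Sum>k<n. if k = 0 then U' $$ (i, 0) * g else 0)"
      using U(2) by (intro sum.cong refl) (auto simp: g_def simp del: index_mult_mat(1))
    finally show ?thesis using assms(1) by simp
  qed
  have "(\<Sum>i<n. z i * w i) = (\<Sum>i<n. z i * U' $$ (i, 0)) * g"
    unfolding sum_distrib_right by (intro sum.cong refl) (auto simp: wi mult.assoc)
  with unimod have h: "(\<Sum>i<n. z i * U' $$ (i, 0)) * g = 1" by simp
  define h where "h = (\<Sum>i<n. z i * U' $$ (i, 0))"
  have h: "h * g = 1" using h by (simp add: h_def)
  let ?D = "mat_diag n (\<lambda>i. if i = 0 then g else 1)"
  let ?D' = "mat_diag n (\<lambda>i. if i = 0 then h else 1)"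
  have "mutually_inverse n ?D ?D'"
  proof -
    have "(\<lambda>i::nat. (if i = 0 then g else 1) * (if i = 0 then h else 1)) = (\<lambda>_. 1)"
      "(\<lambda>i::nat. (if i = 0 then h else 1) * (if i = 0 then g else 1)) = (\<lambda>_. 1)"
      using h by (auto simp: mult.commute)
    then show ?thesis by (simp add: mutually_inverse_def)
  qed
  from mutually_inverse_mult[OF mutually_inverse_sym[OF U(1)] this]
  have "mutually_inverse n (U' * ?D) (?D' * U)" .
  moreover have "(U' * ?D) $$ (i, 0) = w i" if "i < n" for i
    using that assms(1) c wi by (simp add: mat_diag_mult_right[of _ n n])
  ultimately show ?thesis by blast
qed

section \<open>Smith normal form\<close>

definition equivalent_mats :: "nat \<Rightarrow> 'a::comm_ring_1 mat \<Rightarrow> 'a mat \<Rightarrow> bool" where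
  "equivalent_mats n A B \<longleftrightarrow> A \<in> carrier_mat n n \<and>
     (\<exists>P P' Q Q'. mutually_inverse n P P' \<and> mutually_inverse n Q Q' \<and> B = P * A * Q)"

lemma equivalent_matsI:
  "\<lbrakk>A \<in> carrier_mat n n; mutually_inverse n P P'; mutually_inverse n Q Q'; B = P * A * Q\<rbrakk>
    \<Longrightarrow> equivalent_mats n A B"
  by (auto simp: equivalent_mats_def)

lemma equivalent_mats_carrier:
  assumes "equivalent_mats n A B"
  shows "A \<in> carrier_mat n n" "B \<in> carrier_mat n n"
  using assms by (auto simp: equivalent_mats_def mutually_inverse_def)

lemma equivalent_mats_refl: "A \<in> carrier_mat n n \<Longrightarrow> equivalent_mats n A A"
  by (rule equivalent_matsI[OF _ mutually_inverse_one mutually_inverse_one]) auto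

lemma equivalent_mats_sym:
  assumes "equivalent_mats n A B"
  shows "equivalent_mats n B A"
proof -
  obtain P P' Q Q' where PQ: "mutually_inverse n P P'" "mutually_inverse n Q Q'" "B = P * A * Q"
    and A: "A \<in> carrier_mat n n"
    using assms by (auto simp: equivalent_mats_def)
  have c: "P \<in> carrier_mat n n" "P' \<in> carrier_mat n n" "Q \<in> carrier_mat n n" "Q' \<in> carrier_mat n n"
    and i: "P' * P = 1\<^sub>m n" "Q * Q' = 1\<^sub>m n"
    using PQ by (auto simp: mutually_inverse_def)
  have "P' * B * Q' = (P' * P) * A * (Q * Q')"
    using c A unfolding PQ(3) by (simp add: assoc_mult_mat[of _ n n _ n _ n])
  then have "A = P' * B * Q'" using i A by simp
  then show ?thesis
    by (rule equivalent_matsI[OF equivalent_mats_carrier(2)[OF assms]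
          mutually_inverse_sym[OF PQ(1)] mutually_inverse_sym[OF PQ(2)]])
qed

lemma equivalent_mats_trans:
  assumes "equivalent_mats n A B" "equivalent_mats n B C"
  shows "equivalent_mats n A C"
proof -
  obtain P P' Q Q' R R' S S' where PQ: "mutually_inverse n P P'" "mutually_inverse n Q Q'" "B = P * A * Q"
    "mutually_inverse n R R'" "mutually_inverse n S S'" "C = R * B * S"
    and A: "A \<in> carrier_mat n n"
    using assms by (auto simp: equivalent_mats_def)
  have c: "P \<in> carrier_mat n n" "Q \<in> carrier_mat n n" "R \<in> carrier_mat n n" "S \<in> carrier_mat n n"
    using PQ by (auto simp: mutually_inverse_def)
  have "C = (R * P) * A * (Q * S)"
    using c A unfolding PQ(3,6) by (simp add: assoc_mult_mat[of _ n n _ n _ n])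
  then show ?thesis
    by (rule equivalent_matsI[OF A mutually_inverse_mult[OF PQ(4,1)] mutually_inverse_mult[OF PQ(2,5)]])
qed

lemma dvd_mult_mat:
  fixes A B :: "'a::comm_ring_1 mat"
  assumes "A \<in> carrier_mat n m" "B \<in> carrier_mat m p" "i < n" "j < p"
    and "(\<forall>i<n. \<forall>k<m. g dvd A $$ (i, k)) \<or> (\<forall>k<m. \<forall>j<p. g dvd B $$ (k, j))"
  shows "g dvd (A * B) $$ (i, j)"
  unfolding index_mult_mat_sum[OF assms(1-4)] using assms(3-5) by (auto intro!: dvd_sum)

lemma equivalent_mats_dvd:
  assumes "equivalent_mats n A B" "\<forall>i<n. \<forall>j<n. g dvd A $$ (i, j)"
  shows "\<forall>i<n. \<forall>j<n. g dvd B $$ (i, j)"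
proof (intro allI impI)
  fix i j assume ij: "i < n" "j < n"
  obtain P Q where PQ: "P \<in> carrier_mat n n" "Q \<in> carrier_mat n n" "B = P * A * Q"
    and A: "A \<in> carrier_mat n n"
    using assms by (auto simp: equivalent_mats_def mutually_inverse_def)
  have "\<forall>i<n. \<forall>k<n. g dvd (P * A) $$ (i, k)"
    using dvd_mult_mat[OF PQ(1) A] assms(2) by blast
  with dvd_mult_mat[of "P * A" n n Q n] PQ A ij show "g dvd B $$ (i, j)" by auto
qed

text \<open>A bilinear gcd \<open>g = p A x\<close> of a nonzero matrix satisfies
  \<open>p (A / g) x = 1\<close>, so both \<open>p\<close> and \<open>x\<close> are unimodular and
  become first columns of invertible matrices; transposing the first one makes \<open>p\<close> a
  first row.\<close>

lemma corner_gcd: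
  fixes A :: "'a::elementary_divisor_domain mat"
  assumes A: "A \<in> carrier_mat n n" and n: "0 < n"
  shows "\<exists>B. equivalent_mats n A B \<and> (\<forall>i<n. \<forall>j<n. B $$ (0, 0) dvd A $$ (i, j))"
proof (cases "\<forall>i<n. \<forall>j<n. A $$ (i, j) = 0")
  case True
  with equivalent_mats_refl[OF A] show ?thesis by auto
next
  case False
  obtain p x where px: "\<And>i j. i < n \<Longrightarrow> j < n \<Longrightarrow> (\<Sum>k<n. \<Sum>l<n. p k * A $$ (k, l) * x l) dvd A $$ (i, j)"
    using bilinear_gcd[of n n "\<lambda>k l. A $$ (k, l)"] by blast
  define g where "g = (\<Sum>k<n. \<Sum>l<n. p k * A $$ (k, l) * x l)"
  note g = px[folded g_def]
  with False have "g \<noteq> 0" by auto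
  define B where "B = (\<lambda>i j. SOME b. A $$ (i, j) = g * b)"
  have B: "A $$ (i, j) = g * B i j" if "i < n" "j < n" for i j
    unfolding B_def using g[OF that] unfolding dvd_def by (rule someI_ex)
  have "g * (\<Sum>k<n. \<Sum>l<n. p k * B k l * x l) = (\<Sum>k<n. \<Sum>l<n. p k * A $$ (k, l) * x l)"
    unfolding sum_distrib_left by (intro sum.cong refl) (simp add: B mult_ac)
  also have "\<dots> = g * 1" by (simp add: g_def)
  finally have 1: "(\<Sum>k<n. \<Sum>l<n. p k * B k l * x l) = 1" using \<open>g \<noteq> 0\<close> by simp
  \<comment> \<open>The vector \<open>B x\<close> witnesses that \<open>p\<close> is unimodular;
    symmetrically \<open>p B\<close> does so for \<open>x\<close>.\<close>
  have "(\<Sum>k<n. (\<Sum>l<n. B k l * x l) * p k) = 1"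
    unfolding 1[symmetric] sum_distrib_right by (intro sum.cong refl) (simp add: mult_ac)
  from unimodular_completion[OF n this] obtain U U' where U: "mutually_inverse n U U'" "\<And>i. i < n \<Longrightarrow> U $$ (i, 0) = p i"
    by blast
  have "(\<Sum>l<n. (\<Sum>k<n. p k * B k l) * x l) = 1"
    unfolding 1[symmetric] sum_distrib_right by (rule sum.swap)
  from unimodular_completion[OF n this] obtain V V' where V: "mutually_inverse n V V'" "\<And>i. i < n \<Longrightarrow> V $$ (i, 0) = x i"
    by blast
  have c: "U \<in> carrier_mat n n" "V \<in> carrier_mat n n" using U V by (auto simp: mutually_inverse_def)
  let ?C = "transpose_mat U * A * V"
  have "?C $$ (0, 0) = (\<Sum>l<n. (transpose_mat U * A) $$ (0, l) * V $$ (l, 0))"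
    using c A n by (intro index_mult_mat_sum) auto
  also have "\<dots> = (\<Sum>l<n. (\<Sum>k<n. transpose_mat U $$ (0, k) * A $$ (k, l)) * V $$ (l, 0))"
    using c A n by (intro sum.cong arg_cong2[of _ _ _ _ "(*)"] index_mult_mat_sum) auto
  also have "\<dots> = (\<Sum>l<n. \<Sum>k<n. p k * A $$ (k, l) * x l)"
    unfolding sum_distrib_right using c n by (intro sum.cong refl) (auto simp: U V)
  also have "\<dots> = g" unfolding g_def by (rule sum.swap)
  finally have "?C $$ (0, 0) = g" .
  moreover have "equivalent_mats n A ?C"
    by (rule equivalent_matsI[OF A mutually_inverse_transpose[OF U(1)] V(1) refl])
  ultimately show ?thesis using g by metis
qed

lemma equivalent_mats_block:
  assumes "equivalent_mats m A A'" "equivalent_mats n B B'"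
  shows "equivalent_mats (m + n) (four_block_mat A (0\<^sub>m m n) (0\<^sub>m n m) B)
    (four_block_mat A' (0\<^sub>m m n) (0\<^sub>m n m) B')"
proof -
  obtain P P' Q Q' R R' S S' where PQ: "mutually_inverse m P P'" "mutually_inverse m Q Q'" "A' = P * A * Q"
    "mutually_inverse n R R'" "mutually_inverse n S S'" "B' = R * B * S"
    and A: "A \<in> carrier_mat m m" "B \<in> carrier_mat n n"
    using assms by (auto simp: equivalent_mats_def)
  have c: "P \<in> carrier_mat m m" "Q \<in> carrier_mat m m" "R \<in> carrier_mat n n" "S \<in> carrier_mat n n"
    using PQ by (auto simp: mutually_inverse_def)
  show ?thesis
    by (rule equivalent_matsI[OF _ mutually_inverse_block[OF PQ(1,4)] mutually_inverse_block[OF PQ(2,5)]])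
      (use c A PQ(3,6) in \<open>auto simp: mult_four_block_mat[of _ m m _ n _ n _ _ m _ n]\<close>)
qed

text \<open>Divisibility of the off-diagonal blocks by \<open>G\<close> is encoded by the factors
  \<open>R\<close> and \<open>C\<close>. Unipotent block matrices with \<open>- C\<close> on the
  left and \<open>- R\<close> on the right perform the elimination.\<close>

lemma clear_row_and_column:
  assumes "G \<in> carrier_mat m m" "D \<in> carrier_mat n n" "R \<in> carrier_mat m n" "C \<in> carrier_mat n m"
  shows "equivalent_mats (m + n) (four_block_mat G (G * R) (C * G) D)
    (four_block_mat G (0\<^sub>m m n) (0\<^sub>m n m) (D - C * G * R))"
proof (rule equivalent_matsI)
  let ?L = "four_block_mat (1\<^sub>m m) (0\<^sub>m m n) (- C) (1\<^sub>m n)"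
  let ?R = "four_block_mat (1\<^sub>m m) (- R) (0\<^sub>m n m) (1\<^sub>m n)"
  show "mutually_inverse (m + n) ?L (four_block_mat (1\<^sub>m m) (0\<^sub>m m n) (- (- C)) (1\<^sub>m n))"
    using assms by (intro mutually_inverse_unipotent_lower) auto
  show "mutually_inverse (m + n) ?R (four_block_mat (1\<^sub>m m) (- (- R)) (0\<^sub>m n m) (1\<^sub>m n))"
    using assms by (intro mutually_inverse_unipotent_upper) auto
  have "?L * four_block_mat G (G * R) (C * G) D = four_block_mat G (G * R) (0\<^sub>m n m) (D - C * G * R)"
  proof -
    have "- C * G + C * G = 0\<^sub>m n m" using assms by (auto intro!: eq_matI)
    moreover have "- C * (G * R) + D = D - C * G * R"
      using assms by (auto intro!: eq_matI simp: assoc_mult_mat[of C n m G m R n])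
    ultimately show ?thesis
      using assms by (subst mult_four_block_mat[of _ m m _ n _ n _ _ m _ n]) auto
  qed
  moreover have "four_block_mat G (G * R) (0\<^sub>m n m) (D - C * G * R) * ?R =
    four_block_mat G (0\<^sub>m m n) (0\<^sub>m n m) (D - C * G * R)"
  proof -
    have "G * - R + G * R = 0\<^sub>m m n" using assms by (auto intro!: eq_matI)
    then show ?thesis
      using assms by (subst mult_four_block_mat[of _ m m _ n _ n _ _ m _ n]) auto
  qed
  ultimately show "four_block_mat G (0\<^sub>m m n) (0\<^sub>m n m) (D - C * G * R) =
    ?L * four_block_mat G (G * R) (C * G) D * ?R" by simp
qed (use assms in auto)

lemma mat_diag_Suc:
  "mat_diag (Suc n) e = four_block_mat (mat 1 1 (\<lambda>_. e 0)) (0\<^sub>m 1 n) (0\<^sub>m n 1) (mat_diag n (\<lambda>i. e (Suc i)))"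
  by (rule eq_matI) (auto simp: mat_diag_def)

lemma smith_normal_form:
  fixes A :: "'a::elementary_divisor_domain mat"
  assumes "A \<in> carrier_mat n n"
  shows "\<exists>e. equivalent_mats n A (mat_diag n e) \<and> (\<forall>i j. i \<le> j \<longrightarrow> j < n \<longrightarrow> e i dvd e j)"
  using assms
proof (induction n arbitrary: A)
  case 0
  then have "A = mat_diag 0 (\<lambda>_. 0)" by (intro eq_matI) (auto simp: mat_diag_def)
  with equivalent_mats_refl[OF 0] show ?case by auto
next
  case (Suc n)
  obtain M where M: "equivalent_mats (Suc n) A M" "\<forall>i<Suc n. \<forall>j<Suc n. M $$ (0, 0) dvd A $$ (i, j)"
    using corner_gcd[OF Suc.prems] by auto
  define g where "g = M $$ (0, 0)"
  have g: "\<forall>i<Suc n. \<forall>j<Suc n. g dvd M $$ (i, j)"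
    using equivalent_mats_dvd[OF M(1) M(2)] by (simp add: g_def)
  have Mc: "M \<in> carrier_mat (Suc n) (Suc n)" using equivalent_mats_carrier[OF M(1)] by simp
  define q where "q = (\<lambda>i j. SOME b. M $$ (i, j) = g * b)"
  have q: "M $$ (i, j) = g * q i j" if "i < Suc n" "j < Suc n" for i j
  proof -
    have "g dvd M $$ (i, j)" using g that by blast
    then show ?thesis unfolding q_def dvd_def by (rule someI_ex)
  qed
  define G where "G = mat 1 1 (\<lambda>_. g)"
  define R where "R = mat 1 n (\<lambda>(i, j). q 0 (Suc j))"
  define C where "C = mat n 1 (\<lambda>(i, j). q (Suc i) 0)"
  define D where "D = mat n n (\<lambda>(i, j). M $$ (Suc i, Suc j))"
  have c: "G \<in> carrier_mat 1 1" "D \<in> carrier_mat n n" "R \<in> carrier_mat 1 n" "C \<in> carrier_mat n 1"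
    by (auto simp: G_def R_def C_def D_def)
  have "M = four_block_mat G (G * R) (C * G) D"
  proof (rule eq_matI)
    fix i j
    assume "i < dim_row (four_block_mat G (G * R) (C * G) D)" "j < dim_col (four_block_mat G (G * R) (C * G) D)"
    then have "i < Suc n" "j < Suc n" using c by auto
    then show "M $$ (i, j) = four_block_mat G (G * R) (C * G) D $$ (i, j)"
      by (cases i; cases j)
        (auto simp: G_def R_def C_def D_def scalar_prod_def q[of 0 "Suc _"] q[of "Suc _" 0] simp flip: g_def)
  qed (use Mc c in auto)
  with clear_row_and_column[OF c]
  have N: "equivalent_mats (Suc n) M (four_block_mat G (0\<^sub>m 1 n) (0\<^sub>m n 1) (D - C * G * R))" by simp
  let ?E = "D - C * G * R"
  have Ec: "?E \<in> carrier_mat n n" using c by auto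
  obtain e where e: "equivalent_mats n ?E (mat_diag n e)" "\<forall>i j. i \<le> j \<longrightarrow> j < n \<longrightarrow> e i dvd e j"
    using Suc.IH[OF Ec] by blast
  define e' where "e' = case_nat g e"
  have "equivalent_mats (Suc n) (four_block_mat G (0\<^sub>m 1 n) (0\<^sub>m n 1) ?E) (mat_diag (Suc n) e')"
    using equivalent_mats_block[OF equivalent_mats_refl[OF c(1)] e(1)]
    by (simp add: mat_diag_Suc e'_def G_def)
  then have eq: "equivalent_mats (Suc n) A (mat_diag (Suc n) e')"
    using M(1) N by (blast intro: equivalent_mats_trans)
  \<comment> \<open>That \<open>g\<close> divides all diagonal entries follows from equivalence with
    \<open>A\<close>, all of whose entries it divides; this extends the divisibility chain at its
    front.\<close>
  have "g dvd e' j" if "j < Suc n" for j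
  proof -
    have "g dvd mat_diag (Suc n) e' $$ (j, j)"
      using equivalent_mats_dvd[OF eq] M(2) that by (auto simp: g_def)
    with that show ?thesis by (simp add: mat_diag_def)
  qed
  with e(2) have "\<forall>i j. i \<le> j \<longrightarrow> j < Suc n \<longrightarrow> e' i dvd e' j"
    by (auto simp: e'_def split: nat.split)
  with eq show ?case by blast
qed

section \<open>Invariant factors\<close>

text \<open>With \<open>pick\<close> the size \<open>k\<close> is explicit, and the row choice
  \<open>pick I\<close> can be replaced by an arbitrary index function.\<close>

lemma minors_altdef:
  "minors k A = {det (mat k k (\<lambda>(i, j). A $$ (pick I i, pick J j))) | I J.
     I \<subseteq> {..<dim_row A} \<and> J \<subseteq> {..<dim_col A} \<and> card I = k \<and> card J = k}"
proof -
  have "submatrix A I J = mat k k (\<lambda>(i, j). A $$ (pick I i, pick J j))"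
    if "I \<subseteq> {..<dim_row A}" "J \<subseteq> {..<dim_col A}" "card I = k" "card J = k" for I J
  proof -
    have "{i. i < dim_row A \<and> i \<in> I} = I" "{j. j < dim_col A \<and> j \<in> J} = J" using that by auto
    with that show ?thesis by (simp add: submatrix_def)
  qed
  then show ?thesis unfolding minors_def by (metis (no_types, lifting))
qed

lemma pick_less:
  assumes "I \<subseteq> {..<n}" "i < card I"
  shows "pick I i < n"
  using pick_in_set[of i I] assms by auto

lemma minors_transpose: "minors k (transpose_mat A) = minors k A"
proof -
  have "minors k A \<subseteq> minors k (transpose_mat A)" for A :: "'a mat"
  proof
    fix x assume "x \<in> minors k A"
    then obtain I J where IJ: "I \<subseteq> {..<dim_row A}" "J \<subseteq> {..<dim_col A}" "card I = k" "card J = k"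
      and x: "x = det (mat k k (\<lambda>(i, j). A $$ (pick I i, pick J j)))"
      by (auto simp: minors_altdef)
    have "mat k k (\<lambda>(i, j). transpose_mat A $$ (pick J i, pick I j)) =
        transpose_mat (mat k k (\<lambda>(i, j). A $$ (pick I i, pick J j)))"
      using IJ by (intro eq_matI) (auto simp: pick_less)
    then have "x = det (mat k k (\<lambda>(i, j). transpose_mat A $$ (pick J i, pick I j)))"
      by (simp add: x det_transpose[of _ k])
    with IJ show "x \<in> minors k (transpose_mat A)" unfolding minors_altdef by auto
  qed
  from this[of A] this[of "transpose_mat A"] show ?thesis by auto
qed

text \<open>An arbitrary row choice \<open>f\<close> gives nothing new: if it is injective, sorting
  its values turns the determinant into a minor up to sign; if not, two rows agree and the
  determinant vanishes.\<close>

lemma dvd_det_reindexed_rows: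
  assumes g: "\<forall>x\<in>minors k A. g dvd x"
    and J: "J \<subseteq> {..<dim_col A}" "card J = k" and f: "\<And>i. i < k \<Longrightarrow> f i < dim_row A"
  shows "g dvd det (mat k k (\<lambda>(i, j). A $$ (f i, pick J j)))"
proof (cases "inj_on f {..<k}")
  case True
  define I where "I = f ` {..<k}"
  have I: "I \<subseteq> {..<dim_row A}" "card I = k" "finite I"
    using f True by (auto simp: I_def card_image)
  \<comment> \<open>\<open>p i\<close> is the rank of \<open>f i\<close> within the image
    \<open>I\<close>; being the identity from \<open>k\<close> on is what \<open>permutes\<close>
    demands.\<close>
  define p where "p = (\<lambda>i. if i < k then card {a\<in>I. a < f i} else i)"
  have pick_p: "pick I (p i) = f i" if "i < k" for i
    using that by (simp add: p_def I_def pick_card_in_set)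
  have p_less: "p i < k" if "i < k" for i
  proof -
    have "f i \<in> I" using that by (auto simp: I_def)
    then have "card {a\<in>I. a < f i} < card I"
      by (intro psubset_card_mono I(3)) auto
    with that show ?thesis by (simp add: p_def I)
  qed
  have "inj_on p {0..<k}"
    by (rule inj_onI) (metis True atLeastLessThan_iff inj_onD lessThan_iff pick_p)
  then have "bij_betw p {0..<k} {0..<k}"
    using p_less by (intro bij_betw_imageI endo_inj_surj) auto
  then have p: "p permutes {0..<k}" by (rule bij_imp_permutes) (auto simp: p_def)
  let ?M = "mat k k (\<lambda>(i, j). A $$ (pick I i, pick J j))"
  have "mat k k (\<lambda>(i, j). A $$ (f i, pick J j)) = mat k k (\<lambda>(i, j). ?M $$ (p i, j))"
    by (intro eq_matI) (auto simp: pick_p p_less)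
  then have "det (mat k k (\<lambda>(i, j). A $$ (f i, pick J j))) = signof p * det ?M"
    using det_permute_rows[of ?M k p] p by simp
  moreover have "det ?M \<in> minors k A" using I J unfolding minors_altdef by auto
  ultimately show ?thesis using g by simp
next
  case False
  then obtain i j where ij: "i < k" "j < k" "i \<noteq> j" "f i = f j" by (auto simp: inj_on_def)
  let ?M = "mat k k (\<lambda>(i, j). A $$ (f i, pick J j))"
  have "row ?M i = row ?M j" using ij by (intro eq_vecI) auto
  then have "det ?M = 0" using ij by (intro det_identical_rows[of _ k i j]) auto
  then show ?thesis by simp
qed

text \<open>By multilinearity in the rows, a minor of \<open>P * A\<close> is a combination of determinants of rows of
  \<open>A\<close>; this replaces the Cauchy--Binet formula.\<close>

lemma dvd_minors_mult_left:
  fixes P A :: "'a::comm_ring_1 mat"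
  assumes P: "P \<in> carrier_mat m n" and A: "A \<in> carrier_mat n l"
    and g: "\<forall>x\<in>minors k A. g dvd x"
  shows "\<forall>x\<in>minors k (P * A). g dvd x"
proof
  fix x assume "x \<in> minors k (P * A)"
  then obtain I J where I: "I \<subseteq> {..<m}" "card I = k" and J: "J \<subseteq> {..<l}" "card J = k"
    and x: "x = det (mat k k (\<lambda>(i, j). (P * A) $$ (pick I i, pick J j)))"
    using P A by (auto simp: minors_altdef)
  let ?r = "\<lambda>i. vec k (\<lambda>j. A $$ (i, pick J j))"
  let ?a = "\<lambda>i s. P $$ (pick I i, s) \<cdot>\<^sub>v ?r s"
  \<comment> \<open>The choice functions are fixed to be the identity outside
    \<open>{0..<k}\<close>, so that each choice of rows is counted once.\<close>
  let ?F = "{f. (\<forall>i\<in>{0..<k}. f i \<in> {0..<n}) \<and> (\<forall>i. i \<notin> {0..<k} \<longrightarrow> f i = i)}"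
  \<comment> \<open>Row \<open>i\<close> of the selected submatrix of \<open>P * A\<close> is a
    linear combination of the restricted rows \<open>?r s\<close> of \<open>A\<close>.\<close>
  have "mat k k (\<lambda>(i, j). (P * A) $$ (pick I i, pick J j)) =
      mat\<^sub>r k k (\<lambda>i. finsum_vec TYPE('a) k (?a i) {0..<n})"
  proof (rule eq_matI, goal_cases)
    case (1 i j)
    then have ij: "i < k" "j < k" by auto
    then have "(P * A) $$ (pick I i, pick J j) = (\<Sum>s<n. P $$ (pick I i, s) * A $$ (s, pick J j))"
      using P A I J by (intro index_mult_mat_sum) (auto simp: pick_less)
    with ij show ?case by (simp add: index_finsum_vec lessThan_atLeast0)
  qed auto
  then have "x = (\<Sum>f\<in>?F. det (mat\<^sub>r k k (\<lambda>i. ?a i (f i))))"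
    unfolding x by (simp only:) (rule det_linear_rows_sum, auto)
  also have "\<dots> = (\<Sum>f\<in>?F. (\<Prod>i\<in>{0..<k}. P $$ (pick I i, f i)) * det (mat\<^sub>r k k (\<lambda>i. ?r (f i))))"
    by (intro sum.cong refl det_rows_mul) auto
  also have "g dvd \<dots>"
  proof (intro dvd_sum dvd_mult)
    fix f assume "f \<in> ?F"
    have "mat\<^sub>r k k (\<lambda>i. ?r (f i)) = mat k k (\<lambda>(i, j). A $$ (f i, pick J j))"
      by (intro eq_matI) auto
    with \<open>f \<in> ?F\<close> show "g dvd det (mat\<^sub>r k k (\<lambda>i. ?r (f i)))"
      using dvd_det_reindexed_rows[OF g, of J f] J A by auto
  qed
  finally show "g dvd x" .
qed

text \<open>Transposition exchanges the two factors and preserves the set of minors.\<close>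

lemma dvd_minors_mult_right:
  fixes A Q :: "'a::comm_ring_1 mat"
  assumes "A \<in> carrier_mat m n" "Q \<in> carrier_mat n l" "\<forall>x\<in>minors k A. g dvd x"
  shows "\<forall>x\<in>minors k (A * Q). g dvd x"
proof -
  have "\<forall>x\<in>minors k (transpose_mat Q * transpose_mat A). g dvd x"
    using assms by (intro dvd_minors_mult_left[of _ l n _ m]) (auto simp: minors_transpose)
  then show ?thesis using minors_transpose[of k "A * Q"] assms by (simp add: transpose_mult)
qed

lemma equivalent_mats_dvd_minors:
  assumes "equivalent_mats n A B" "\<forall>x\<in>minors k A. g dvd x"
  shows "\<forall>x\<in>minors k B. g dvd x"
proof -
  obtain P Q where P: "P \<in> carrier_mat n n" and Q: "Q \<in> carrier_mat n n" and B: "B = P * A * Q"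
    and A: "A \<in> carrier_mat n n"
    using assms by (auto simp: equivalent_mats_def mutually_inverse_def)
  have "\<forall>x\<in>minors k (P * A). g dvd x" by (rule dvd_minors_mult_left[OF P A assms(2)])
  then show ?thesis unfolding B by (rule dvd_minors_mult_right[OF mult_carrier_mat[OF P A] Q])
qed

text \<open>Since equivalence is symmetric, the minors of both matrices have the same common
  divisors, and these alone determine which elements are gcds.\<close>

lemma equivalent_mats_is_gcd_minors:
  assumes "equivalent_mats n A B"
  shows "is_gcd (minors k A) g \<longleftrightarrow> is_gcd (minors k B) g"
proof -
  have "(\<forall>x\<in>minors k A. h dvd x) \<longleftrightarrow> (\<forall>x\<in>minors k B. h dvd x)" for h
  proof
    show "\<forall>x\<in>minors k B. h dvd x" if "\<forall>x\<in>minors k A. h dvd x"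
      by (rule equivalent_mats_dvd_minors[OF assms that])
    show "\<forall>x\<in>minors k A. h dvd x" if "\<forall>x\<in>minors k B. h dvd x"
      by (rule equivalent_mats_dvd_minors[OF equivalent_mats_sym[OF assms] that])
  qed
  then show ?thesis by (simp add: is_gcd_def)
qed

lemma equivalent_mats_invariant_factor:
  assumes "equivalent_mats n A B"
  shows "invariant_factor k A = invariant_factor k B"
  using equivalent_mats_is_gcd_minors[OF assms]
  by (simp add: invariant_factor_def determinantal_divisor_def)

section \<open>Determinantal divisors of diagonal matrices\<close>

lemma le_pick:
  assumes "i < card I"
  shows "i \<le> pick I i"
proof -
  \<comment> \<open>Counting from zero, exactly \<open>i\<close> elements of \<open>I\<close> lie
    below the \<open>i\<close>-th one, and they are among all the numbers below it.\<close>
  have "i = card {a\<in>I. a < pick I i}" using card_pick[of i I] assms by simp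
  also have "\<dots> \<le> card {..<pick I i}" by (intro card_mono) auto
  finally show ?thesis by simp
qed

lemma det_mat_diag: "det (mat_diag n e) = (\<Prod>i<n. e i)"
proof -
  have "det (mat_diag n e) = prod_list (diag_mat (mat_diag n e))"
    by (rule det_upper_triangular[of _ n]) (auto simp: mat_diag_def)
  also have "diag_mat (mat_diag n e) = map e [0..<n]" by (auto simp: diag_mat_def mat_diag_def)
  also have "prod_list \<dots> = (\<Prod>i<n. e i)"
    by (simp add: prod.distinct_set_conv_list[symmetric] lessThan_atLeast0)
  finally show ?thesis .
qed

text \<open>By the Leibniz formula each minor is a sum of products with one factor per row, and row
  \<open>i\<close> is divisible by \<open>e i\<close>. Conversely the product is itself the leading
  principal minor.\<close>

lemma is_gcd_minors_mat_diag:
  fixes e :: "nat \<Rightarrow> 'a::comm_ring_1"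
  assumes e: "\<And>i j. i \<le> j \<Longrightarrow> j < n \<Longrightarrow> e i dvd e j" and "k \<le> n"
  shows "is_gcd (minors k (mat_diag n e)) (\<Prod>i<k. e i)"
proof -
  have dims: "dim_row (mat_diag n e) = n" "dim_col (mat_diag n e) = n" by (auto simp: mat_diag_def)
  have "(\<Prod>i<k. e i) dvd x" if "x \<in> minors k (mat_diag n e)" for x
  proof -
    from that obtain I J where I: "I \<subseteq> {..<n}" "card I = k" and J: "J \<subseteq> {..<n}" "card J = k"
      and x: "x = det (mat k k (\<lambda>(i, j). mat_diag n e $$ (pick I i, pick J j)))"
      by (auto simp: minors_altdef dims)
    let ?M = "mat k k (\<lambda>(i, j). mat_diag n e $$ (pick I i, pick J j))"
    \<comment> \<open>A nonzero entry equals \<open>e (pick I i)\<close>, and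
      \<open>i \<le> pick I i\<close> puts \<open>e i\<close> before it in the divisibility
      chain.\<close>
    have entry: "e i dvd ?M $$ (i, j)" if "i < k" "j < k" for i j
      using that I J e[OF le_pick, of i I] by (auto simp: mat_diag_def pick_less)
    have "x = (\<Sum>p | p permutes {0..<k}. signof p * (\<Prod>i = 0..<k. ?M $$ (i, p i)))"
      unfolding x by (rule det_def') simp
    also have "(\<Prod>i<k. e i) dvd \<dots>"
    proof (intro dvd_sum dvd_mult)
      fix p assume "p \<in> {p. p permutes {0..<k}}"
      then have "p i < k" if "i < k" for i using that permutes_in_image[of p "{0..<k}" i] by auto
      then show "(\<Prod>i<k. e i) dvd (\<Prod>i = 0..<k. ?M $$ (i, p i))"
        unfolding lessThan_atLeast0 by (intro prod_dvd_prod entry) auto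
    qed
    finally show ?thesis .
  qed
  moreover have "(\<Prod>i<k. e i) \<in> minors k (mat_diag n e)"
  proof -
    have pick: "pick {..<k} i = i" if "i < k" for i
    proof -
      have "{a \<in> {..<k}. a < i} = {..<i}" using that by auto
      with pick_card_in_set[of i "{..<k}"] that show ?thesis by simp
    qed
    have "mat_diag k e = mat k k (\<lambda>(i, j). mat_diag n e $$ (pick {..<k} i, pick {..<k} j))"
      using assms(2) by (intro eq_matI) (auto simp: mat_diag_def pick)
    then have "(\<Prod>i<k. e i) = det (mat k k (\<lambda>(i, j). mat_diag n e $$ (pick {..<k} i, pick {..<k} j)))"
      by (simp flip: det_mat_diag)
    with assms(2) show ?thesis
      unfolding minors_altdef dims by (intro CollectI exI[of _ "{..<k}"]) auto
  qed
  ultimately show ?thesis by (auto simp: is_gcd_def)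
qed

lemma is_gcd_unique: "is_gcd S g \<Longrightarrow> is_gcd S h \<Longrightarrow> g dvd h"
  by (auto simp: is_gcd_def)

text \<open>For \<open>k = 0\<close> the class consists of the units, which matches the empty
  product.\<close>

lemma determinantal_divisor_mat_diag:
  fixes e :: "nat \<Rightarrow> 'a::idom"
  assumes e: "\<And>i j. i \<le> j \<Longrightarrow> j < n \<Longrightarrow> e i dvd e j" and "k \<le> n"
  shows "(\<Prod>i<k. e i) \<in> determinantal_divisor k (mat_diag n e)"
    and "g \<in> determinantal_divisor k (mat_diag n e) \<Longrightarrow> g dvd (\<Prod>i<k. e i) \<and> (\<Prod>i<k. e i) dvd g"
  using is_gcd_minors_mat_diag[where e = e, OF assms]
  by (auto simp: determinantal_divisor_def dest: is_gcd_unique split: if_splits)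

text \<open>Consecutive determinantal divisors are, up to units, a product \<open>p\<close> of
  diagonal entries and \<open>p * e k\<close>, and the nonzero \<open>p\<close> can be cancelled.
  The diagonal is indexed from zero and invariant factors from one, hence
  \<open>Suc k\<close>.\<close>

lemma invariant_factor_mat_diag:
  fixes e :: "nat \<Rightarrow> 'a::idom"
  assumes e: "\<And>i j. i \<le> j \<Longrightarrow> j < n \<Longrightarrow> e i dvd e j" and nz: "\<And>i. i < n \<Longrightarrow> e i \<noteq> 0" and "k < n"
  shows "d \<in> invariant_factor (Suc k) (mat_diag n e) \<Longrightarrow> d dvd e k \<and> e k dvd d"
    and "e k \<in> invariant_factor (Suc k) (mat_diag n e)"
proof -
  let ?p = "\<Prod>i<k. e i"
  have "?p \<noteq> 0" using nz assms(3) by auto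
  note D = determinantal_divisor_mat_diag[where e = e, OF e]
  show "d dvd e k \<and> e k dvd d" if d: "d \<in> invariant_factor (Suc k) (mat_diag n e)"
  proof -
    obtain h where h: "d * h \<in> determinantal_divisor (Suc k) (mat_diag n e)"
        "h \<in> determinantal_divisor k (mat_diag n e)"
      using d by (auto simp: invariant_factor_def)
    have 1: "d * h dvd ?p * e k" "?p * e k dvd d * h" using D(2)[OF _ _ _ h(1)] assms(3) by (auto simp: mult.commute)
    have 2: "h dvd ?p" "?p dvd h" using D(2)[OF _ _ _ h(2)] assms(3) by auto
    \<comment> \<open>Divisibility between \<open>h\<close> and \<open>?p\<close> in both directions
      allows \<open>h\<close> to be replaced by \<open>?p\<close> before cancelling.\<close>
    have "d * ?p dvd ?p * e k" by (rule dvd_trans[OF mult_dvd_mono[OF dvd_refl 2(2)] 1(1)])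
    moreover have "?p * e k dvd d * ?p" by (rule dvd_trans[OF 1(2) mult_dvd_mono[OF dvd_refl 2(1)]])
    ultimately show ?thesis using \<open>?p \<noteq> 0\<close> by (simp add: mult.commute)
  qed
  show "e k \<in> invariant_factor (Suc k) (mat_diag n e)"
  proof -
    have "e k * ?p \<in> determinantal_divisor (Suc k) (mat_diag n e)" "?p \<in> determinantal_divisor k (mat_diag n e)"
      using D(1)[of n "Suc k"] D(1)[of n k] assms(3) by (auto simp: mult.commute)
    then show ?thesis unfolding invariant_factor_def by auto
  qed
qed

section \<open>Functors isomorphic to the identity\<close>

lemma (in category) functor_between_id: "functor_between C C id_func"
  by unfold_locales (auto simp: id_func_def)

text \<open>The identity functor serves as quasi-inverse, since both composites with it equal
  \<open>F\<close>.\<close>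

lemma (in category) autoequivalence_if_func_isomorphic_id:
  assumes "func_isomorphic C C F id_func"
  shows "autoequivalence C F"
proof -
  have "functor_between C C F" using assms by (simp add: func_isomorphic_def)
  moreover have "comp_func id_func F = F" "comp_func F id_func = F"
    by (simp_all add: comp_func_def id_func_def)
  ultimately show ?thesis
    using assms functor_between_id unfolding equivalence_of_categories_def by auto
qed

text \<open>Transport of the identity functor along a choice of isomorphisms.\<close>

lemma (in category) func_isomorphic_id_if_isos:
  assumes T: "\<And>a. a \<in> Ob C \<Longrightarrow> T a \<in> Ob C"
    and iso: "\<And>a. a \<in> Ob C \<Longrightarrow> \<exists>f. is_iso C (T a) a f"
  shows "\<exists>F. omap F = T \<and> func_isomorphic C C F id_func"
proof -
  have "\<exists>f g. a \<in> Ob C \<longrightarrow> f \<in> Hom C (T a) a \<and> g \<in> Hom C a (T a) \<and>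
      Comp C g f = Idn C (T a) \<and> Comp C f g = Idn C a" for a
    using iso[of a] by (auto simp: is_iso_def)
  then obtain \<eta> \<theta> where
    "\<And>a. a \<in> Ob C \<longrightarrow> \<eta> a \<in> Hom C (T a) a \<and> \<theta> a \<in> Hom C a (T a) \<and>
      Comp C (\<theta> a) (\<eta> a) = Idn C (T a) \<and> Comp C (\<eta> a) (\<theta> a) = Idn C a"
    by metis
  then have \<eta>: "\<eta> a \<in> Hom C (T a) a" and \<theta>: "\<theta> a \<in> Hom C a (T a)"
    and \<theta>\<eta>: "Comp C (\<theta> a) (\<eta> a) = Idn C (T a)" and \<eta>\<theta>: "Comp C (\<eta> a) (\<theta> a) = Idn C a"
    if "a \<in> Ob C" for a
    using that by blast+
  \<comment> \<open>On morphisms \<open>F\<close> conjugates by the chosen isomorphisms, which is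
    what naturality of \<open>\<eta>\<close> dictates.\<close>
  define F where "F = \<lparr>omap = T, amap = (\<lambda>a b f. Comp C (\<theta> b) (Comp C f (\<eta> a)))\<rparr>"
  have Hom: "Comp C f (\<eta> a) \<in> Hom C (T a) b" if "a \<in> Ob C" "b \<in> Ob C" "f \<in> Hom C a b" for a b f
    by (rule Comp_in_Hom[OF T[OF that(1)] that(1,2) \<eta>[OF that(1)] that(3)])
  have cancel: "Comp C (\<eta> b) (Comp C (\<theta> b) g) = g" if "a \<in> Ob C" "b \<in> Ob C" "g \<in> Hom C a b" for a b g
    using Comp_assoc[OF that(1,2) T[OF that(2)] that(2,3) \<theta>[OF that(2)] \<eta>[OF that(2)]]
      Idn_Comp[OF that] \<eta>\<theta>[OF that(2)] by simp
  have F_functor: "functor_between C C F"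
  proof
    fix a assume a: "a \<in> Ob C"
    then show "omap F a \<in> Ob C" by (simp add: F_def T)
    show "amap F a a (Idn C a) = Idn C (omap F a)"
      using Idn_Comp[OF T[OF a] a \<eta>[OF a]] \<theta>\<eta>[OF a] by (simp add: F_def)
  next
    fix a b f assume ab: "a \<in> Ob C" "b \<in> Ob C" "f \<in> Hom C a b"
    show "amap F a b f \<in> Hom C (omap F a) (omap F b)"
      using Comp_in_Hom[OF T[OF ab(1)] ab(2) T[OF ab(2)] Hom[OF ab] \<theta>[OF ab(2)]] by (simp add: F_def)
  next
    fix a b c f g
    assume a: "a \<in> Ob C" and b: "b \<in> Ob C" and c: "c \<in> Ob C" and f: "f \<in> Hom C a b" and g: "g \<in> Hom C b c"
    let ?f = "Comp C (\<theta> b) (Comp C f (\<eta> a))"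
    note f\<eta> = Hom[OF a b f]
    have F_f: "?f \<in> Hom C (T a) (T b)" by (rule Comp_in_Hom[OF T[OF a] b T[OF b] f\<eta> \<theta>[OF b]])
    have "Comp C (Comp C (\<theta> c) (Comp C g (\<eta> b))) ?f = Comp C (\<theta> c) (Comp C (Comp C g (\<eta> b)) ?f)"
      by (rule Comp_assoc[OF T[OF a] T[OF b] c T[OF c] F_f Hom[OF b c g] \<theta>[OF c]])
    also have "Comp C (Comp C g (\<eta> b)) ?f = Comp C g (Comp C (\<eta> b) ?f)"
      by (rule Comp_assoc[OF T[OF a] T[OF b] b c F_f \<eta>[OF b] g])
    also have "Comp C (\<eta> b) ?f = Comp C f (\<eta> a)" by (rule cancel[OF T[OF a] b f\<eta>])
    also have "Comp C g (Comp C f (\<eta> a)) = Comp C (Comp C g f) (\<eta> a)"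
      by (rule Comp_assoc[OF T[OF a] a b c \<eta>[OF a] f g, symmetric])
    finally show "amap F a c (Comp C g f) = Comp C (amap F b c g) (amap F a b f)"
      by (simp add: F_def)
  qed
  \<comment> \<open>Naturality is the cancellation of \<open>\<eta> b\<close> against
    \<open>\<theta> b\<close>.\<close>
  moreover have "natural_iso C C F id_func \<eta>"
    unfolding natural_iso_def is_iso_def
    using \<eta> \<theta> \<theta>\<eta> \<eta>\<theta> cancel[OF T _ Hom] by (simp add: F_def id_func_def) blast
  ultimately have "func_isomorphic C C F id_func"
    using functor_between_id by (auto simp: func_isomorphic_def)
  moreover have "omap F = T" by (simp add: F_def)
  ultimately show ?thesis by blast
qed

section \<open>The category of matrix factorizations\<close>

lemma four_block_mat_inject:
  assumes c: "A \<in> carrier_mat m n" "B \<in> carrier_mat m q" "C \<in> carrier_mat p n" "D \<in> carrier_mat p q"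
    and c': "A' \<in> carrier_mat m n" "B' \<in> carrier_mat m q" "C' \<in> carrier_mat p n" "D' \<in> carrier_mat p q"
    and eq: "four_block_mat A B C D = four_block_mat A' B' C' D'"
  shows "A = A'" "B = B'" "C = C'" "D = D'"
proof -
  have ij: "four_block_mat A B C D $$ (i, j) = four_block_mat A' B' C' D' $$ (i, j)" for i j
    by (simp add: eq)
  show "A = A'"
  proof (rule eq_matI)
    fix i j assume "i < dim_row A'" "j < dim_col A'"
    then show "A $$ (i, j) = A' $$ (i, j)" using c c' ij[of i j] by auto
  qed (use c c' in auto)
  show "B = B'"
  proof (rule eq_matI)
    fix i j assume "i < dim_row B'" "j < dim_col B'"
    then show "B $$ (i, j) = B' $$ (i, j)" using c c' ij[of i "j + n"] by auto
  qed (use c c' in auto)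
  show "C = C'"
  proof (rule eq_matI)
    fix i j assume "i < dim_row C'" "j < dim_col C'"
    then show "C $$ (i, j) = C' $$ (i, j)" using c c' ij[of "i + m" j] by auto
  qed (use c c' in auto)
  show "D = D'"
  proof (rule eq_matI)
    fix i j assume "i < dim_row D'" "j < dim_col D'"
    then show "D $$ (i, j) = D' $$ (i, j)" using c c' ij[of "i + m" "j + n"] by auto
  qed (use c c' in auto)
qed

lemma odd_mat_carrier:
  "\<lbrakk>u \<in> carrier_mat \<rho> \<rho>; v \<in> carrier_mat \<rho> \<rho>\<rbrakk> \<Longrightarrow> odd_mat \<rho> u v \<in> carrier_mat (\<rho> + \<rho>) (\<rho> + \<rho>)"
  by (auto simp: odd_mat_def)

text \<open>The square of an odd matrix is block diagonal with blocks \<open>v * u\<close> and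
  \<open>u * v\<close>, to be compared with the blocks of the scalar matrix.\<close>

lemma Ob_zmf_odd_mat_iff:
  fixes u v :: "'a::idom mat"
  assumes "u \<in> carrier_mat \<rho> \<rho>" "v \<in> carrier_mat \<rho> \<rho>"
  shows "(\<rho>, odd_mat \<rho> u v) \<in> Ob (zmf W) \<longleftrightarrow> v * u = W \<cdot>\<^sub>m 1\<^sub>m \<rho> \<and> u * v = W \<cdot>\<^sub>m 1\<^sub>m \<rho>"
proof -
  have 1: "odd_mat \<rho> u v * odd_mat \<rho> u v = four_block_mat (v * u) (0\<^sub>m \<rho> \<rho>) (0\<^sub>m \<rho> \<rho>) (u * v)"
    unfolding odd_mat_def using assms by (subst mult_four_block_mat[of _ \<rho> \<rho> _ \<rho> _ \<rho> _ _ \<rho> _ \<rho>]) auto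
  have 2: "W \<cdot>\<^sub>m 1\<^sub>m (\<rho> + \<rho>) =
      four_block_mat (W \<cdot>\<^sub>m 1\<^sub>m \<rho>) (0\<^sub>m \<rho> \<rho>) (0\<^sub>m \<rho> \<rho>) (W \<cdot>\<^sub>m 1\<^sub>m \<rho>)"
    by (intro eq_matI) auto
  have "(\<rho>, odd_mat \<rho> u v) \<in> Ob (zmf W) \<longleftrightarrow>
      four_block_mat (v * u) (0\<^sub>m \<rho> \<rho>) (0\<^sub>m \<rho> \<rho>) (u * v) =
      four_block_mat (W \<cdot>\<^sub>m 1\<^sub>m \<rho>) (0\<^sub>m \<rho> \<rho>) (0\<^sub>m \<rho> \<rho>) (W \<cdot>\<^sub>m 1\<^sub>m \<rho>)"
    using assms unfolding zmf_def odd_endos_def by (auto simp flip: 1 2)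
  also have "\<dots> \<longleftrightarrow> v * u = W \<cdot>\<^sub>m 1\<^sub>m \<rho> \<and> u * v = W \<cdot>\<^sub>m 1\<^sub>m \<rho>"
    using four_block_mat_inject(1,4)[of "v * u" \<rho> \<rho> "0\<^sub>m \<rho> \<rho>" \<rho> "0\<^sub>m \<rho> \<rho>" \<rho> "u * v"
        "W \<cdot>\<^sub>m 1\<^sub>m \<rho>" "0\<^sub>m \<rho> \<rho>" "0\<^sub>m \<rho> \<rho>" "W \<cdot>\<^sub>m 1\<^sub>m \<rho>"] assms by auto
  finally show ?thesis .
qed

lemma Ob_zmfE:
  assumes "a \<in> Ob (zmf W)"
  obtains \<rho> u v where "a = (\<rho>, odd_mat \<rho> u v)" "u \<in> carrier_mat \<rho> \<rho>" "v \<in> carrier_mat \<rho> \<rho>"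
  using assms by (auto simp: zmf_def odd_endos_def)

lemma Hom_zmf_iff:
  "f \<in> Hom (zmf W) a b \<longleftrightarrow> f \<in> even_maps (fst a) (fst b) \<and> snd b * f = f * snd a"
  by (auto simp: zmf_def split: prod.splits)

lemma even_maps_carrier: "f \<in> even_maps m n \<Longrightarrow> f \<in> carrier_mat (n + n) (m + m)"
  by (auto simp: even_maps_def)

lemma even_maps_one: "1\<^sub>m (n + n) \<in> even_maps n n"
  unfolding even_maps_def by (rule CollectI) (metis four_block_one_mat one_carrier_mat)

lemma even_maps_mult:
  fixes f g :: "'a::idom mat"
  assumes "f \<in> even_maps l m" "g \<in> even_maps m n"
  shows "g * f \<in> even_maps l n"
proof -
  obtain f0 f1 where f: "f = four_block_mat f0 (0\<^sub>m m l) (0\<^sub>m m l) f1" "f0 \<in> carrier_mat m l" "f1 \<in> carrier_mat m l"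
    using assms by (auto simp: even_maps_def)
  obtain g0 g1 where g: "g = four_block_mat g0 (0\<^sub>m n m) (0\<^sub>m n m) g1" "g0 \<in> carrier_mat n m" "g1 \<in> carrier_mat n m"
    using assms by (auto simp: even_maps_def)
  have "g * f = four_block_mat (g0 * f0) (0\<^sub>m n l) (0\<^sub>m n l) (g1 * f1)"
    unfolding f(1) g(1) using f g by (subst mult_four_block_mat[of _ n m _ m _ n _ _ l _ l]) auto
  with f g show ?thesis unfolding even_maps_def by (auto intro!: mult_carrier_mat)
qed

lemma category_zmf: "category (zmf W)"
proof
  fix a assume "a \<in> Ob (zmf W)"
  then obtain \<rho> D where a: "a = (\<rho>, D)" "D \<in> carrier_mat (\<rho> + \<rho>) (\<rho> + \<rho>)"
    by (metis Ob_zmfE odd_mat_carrier)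
  then show "Idn (zmf W) a \<in> Hom (zmf W) a a"
    by (simp add: Hom_zmf_iff) (simp add: zmf_def even_maps_one)
next
  fix a b c f g assume ob: "a \<in> Ob (zmf W)" "b \<in> Ob (zmf W)" "c \<in> Ob (zmf W)"
    and fg: "f \<in> Hom (zmf W) a b" "g \<in> Hom (zmf W) b c"
  have D: "snd x \<in> carrier_mat (fst x + fst x) (fst x + fst x)" if "x \<in> Ob (zmf W)" for x
    using that by (metis Ob_zmfE odd_mat_carrier fst_conv snd_conv)
  note c = D[OF ob(1)] D[OF ob(2)] D[OF ob(3)]
  have f: "f \<in> even_maps (fst a) (fst b)" "snd b * f = f * snd a"
    and g: "g \<in> even_maps (fst b) (fst c)" "snd c * g = g * snd b"
    using fg by (auto simp: Hom_zmf_iff)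
  note fc = even_maps_carrier[OF f(1)] and gc = even_maps_carrier[OF g(1)]
  have "snd c * (g * f) = snd c * g * f" by (rule assoc_mult_mat[OF c(3) gc fc, symmetric])
  also have "\<dots> = g * (snd b * f)" unfolding g(2) by (rule assoc_mult_mat[OF gc c(2) fc])
  also have "\<dots> = g * f * snd a" unfolding f(2) by (rule assoc_mult_mat[OF gc fc c(1), symmetric])
  finally have "g * f \<in> Hom (zmf W) a c"
    using even_maps_mult[OF f(1) g(1)] by (simp add: Hom_zmf_iff)
  then show "Comp (zmf W) g f \<in> Hom (zmf W) a c" by (simp add: zmf_def)
next
  fix a b f assume "f \<in> Hom (zmf W) a b"
  then have "f \<in> carrier_mat (fst b + fst b) (fst a + fst a)"
    by (simp add: Hom_zmf_iff even_maps_carrier)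
  then show "Comp (zmf W) f (Idn (zmf W) a) = f" "Comp (zmf W) (Idn (zmf W) b) f = f"
    by (auto simp: zmf_def split: prod.splits)
next
  fix a b c d f g h
  assume "f \<in> Hom (zmf W) a b" "g \<in> Hom (zmf W) b c" "h \<in> Hom (zmf W) c d"
  then have "f \<in> carrier_mat (fst b + fst b) (fst a + fst a)"
    "g \<in> carrier_mat (fst c + fst c) (fst b + fst b)" "h \<in> carrier_mat (fst d + fst d) (fst c + fst c)"
    by (simp_all add: Hom_zmf_iff even_maps_carrier)
  then show "Comp (zmf W) (Comp (zmf W) h g) f = Comp (zmf W) h (Comp (zmf W) g f)"
    by (simp add: zmf_def)
qed

section \<open>Decomposition into elementary factorizations\<close>

lemma mf_blocks_odd_mat:
  assumes "u \<in> carrier_mat \<rho> \<rho>" "v \<in> carrier_mat \<rho> \<rho>"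
  shows "mf_u (\<rho>, odd_mat \<rho> u v) = u" "mf_v (\<rho>, odd_mat \<rho> u v) = v"
  using assms by (auto simp: split_block_def odd_mat_def Let_def intro!: eq_matI)

text \<open>The lower end \<open>a\<close> is arbitrary because removing the head of the interval
  shifts it in the induction.\<close>

lemma diag_block_mat_singletons:
  "diag_block_mat (map (\<lambda>i. mat 1 1 (\<lambda>_. f i)) [a..<a + n]) = mat_diag n (\<lambda>i. f (a + i))"
proof (induction n arbitrary: a)
  case 0
  then show ?case by (auto simp: mat_diag_def)
next
  case (Suc n)
  have "[a..<a + Suc n] = a # [Suc a..<Suc a + n]" by (simp add: upt_conv_Cons)
  moreover have "mat_diag (Suc n) (\<lambda>i. f (a + i)) = four_block_mat (mat 1 1 (\<lambda>_. f a)) (0\<^sub>m 1 n) (0\<^sub>m n 1)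
      (mat_diag n (\<lambda>i. f (Suc a + i)))"
    by (simp add: mat_diag_Suc)
  moreover have "dim_row (mat_diag n g) = n" "dim_col (mat_diag n g) = n" for g :: "nat \<Rightarrow> 'a"
    by (auto simp: mat_diag_def)
  ultimately show ?case using Suc.IH[of "Suc a"] by (simp add: Let_def)
qed

lemma direct_sum_elementary_mf:
  "direct_sum_mf (map (\<lambda>i. elementary_mf W (d i)) [1..<Suc \<rho>]) =
    (\<rho>, odd_mat \<rho> (mat_diag \<rho> (\<lambda>i. THE w. W = d (Suc i) * w)) (mat_diag \<rho> (\<lambda>i. d (Suc i))))"
proof -
  have "mf_u (elementary_mf W x) = mat 1 1 (\<lambda>_. THE w. W = x * w)"
    "mf_v (elementary_mf W x) = mat 1 1 (\<lambda>_. x)" for x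
    unfolding elementary_mf_def by (rule mf_blocks_odd_mat; simp)+
  \<comment> \<open>The interval is written with upper end \<open>1 + \<rho>\<close> to fit the form
    \<open>[a..<a + n]\<close> with \<open>a = 1\<close>; this causes the shift to
    \<open>d (Suc i)\<close>.\<close>
  then have *: "map mf_u (map (\<lambda>i. elementary_mf W (d i)) [1..<1 + \<rho>]) = map (\<lambda>i. mat 1 1 (\<lambda>_. THE w. W = d i * w)) [1..<1 + \<rho>]"
    "map mf_v (map (\<lambda>i. elementary_mf W (d i)) [1..<1 + \<rho>]) = map (\<lambda>i. mat 1 1 (\<lambda>_. d i)) [1..<1 + \<rho>]"
    by simp_all
  have "fst (elementary_mf W x) = 1" for x by (simp add: elementary_mf_def)
  then have "sum_list (map fst (map (\<lambda>i. elementary_mf W (d i)) [1..<1 + \<rho>])) = \<rho>"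
    by (simp add: o_def sum_list_triv del: upt_Suc)
  then show ?thesis
    unfolding direct_sum_mf_def plus_1_eq_Suc[symmetric] Let_def * diag_block_mat_singletons by simp
qed

lemma odd_mat_mult_even:
  fixes u v f g :: "'a::idom mat"
  assumes "u \<in> carrier_mat n n" "v \<in> carrier_mat n n" "f \<in> carrier_mat n n" "g \<in> carrier_mat n n"
  shows "odd_mat n u v * four_block_mat f (0\<^sub>m n n) (0\<^sub>m n n) g = four_block_mat (0\<^sub>m n n) (v * g) (u * f) (0\<^sub>m n n)"
    and "four_block_mat f (0\<^sub>m n n) (0\<^sub>m n n) g * odd_mat n u v = four_block_mat (0\<^sub>m n n) (f * v) (g * u) (0\<^sub>m n n)"
  unfolding odd_mat_def using assms by (auto simp: mult_four_block_mat[of _ n n _ n _ n _ _ n _ n])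

text \<open>This is a change of basis, by \<open>P\<close> on the even part and by \<open>Q'\<close>
  on the odd part; going back to the given factorization uses \<open>P'\<close> and
  \<open>Q\<close>.\<close>

lemma zmf_is_isoI:
  fixes u v :: "'a::idom mat"
  assumes u: "u \<in> carrier_mat \<rho> \<rho>" and v: "v \<in> carrier_mat \<rho> \<rho>"
    and P: "mutually_inverse \<rho> P P'" and Q: "mutually_inverse \<rho> Q Q'"
  shows "is_iso (zmf W) (\<rho>, odd_mat \<rho> (Q' * u * P') (P * v * Q)) (\<rho>, odd_mat \<rho> u v)
    (four_block_mat P' (0\<^sub>m \<rho> \<rho>) (0\<^sub>m \<rho> \<rho>) Q)"
proof -
  have c: "P \<in> carrier_mat \<rho> \<rho>" "P' \<in> carrier_mat \<rho> \<rho>" "Q \<in> carrier_mat \<rho> \<rho>" "Q' \<in> carrier_mat \<rho> \<rho>"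
    using P Q by (auto simp: mutually_inverse_def)
  let ?u = "Q' * u * P'" and ?v = "P * v * Q"
  let ?f = "four_block_mat P' (0\<^sub>m \<rho> \<rho>) (0\<^sub>m \<rho> \<rho>) Q"
  let ?g = "four_block_mat P (0\<^sub>m \<rho> \<rho>) (0\<^sub>m \<rho> \<rho>) Q'"
  have u': "?u \<in> carrier_mat \<rho> \<rho>" and v': "?v \<in> carrier_mat \<rho> \<rho>" using c u v by auto
  have even: "?f \<in> even_maps \<rho> \<rho>" "?g \<in> even_maps \<rho> \<rho>" unfolding even_maps_def using c by blast+
  have v1: "P' * ?v = v * Q"
    using mutually_inverse_cancel[OF mutually_inverse_sym[OF P], of "v * Q" \<rho>] assoc_mult_mat[OF c(1) v c(3)] c v
    by simp
  have u1: "Q * ?u = u * P'"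
    using mutually_inverse_cancel[OF Q, of "u * P'" \<rho>] assoc_mult_mat[OF c(4) u c(2)] c u by simp
  have v2: "?v * Q' = P * v"
    using assoc_mult_mat[of "P * v" \<rho> \<rho> Q \<rho> Q' \<rho>] Q c v by (simp add: mutually_inverse_def)
  have u2: "?u * P = Q' * u"
    using assoc_mult_mat[of "Q' * u" \<rho> \<rho> P' \<rho> P \<rho>] P c u by (simp add: mutually_inverse_def)
  have "odd_mat \<rho> u v * ?f = ?f * odd_mat \<rho> ?u ?v"
    unfolding odd_mat_mult_even(1)[OF u v c(2,3)] odd_mat_mult_even(2)[OF u' v' c(2,3)] u1 v1 ..
  then have f: "?f \<in> Hom (zmf W) (\<rho>, odd_mat \<rho> ?u ?v) (\<rho>, odd_mat \<rho> u v)"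
    using even by (simp add: Hom_zmf_iff)
  have "odd_mat \<rho> ?u ?v * ?g = ?g * odd_mat \<rho> u v"
    unfolding odd_mat_mult_even(2)[OF u v c(1,4)] odd_mat_mult_even(1)[OF u' v' c(1,4)] u2 v2 ..
  then have g: "?g \<in> Hom (zmf W) (\<rho>, odd_mat \<rho> u v) (\<rho>, odd_mat \<rho> ?u ?v)"
    using even by (simp add: Hom_zmf_iff)
  have "?g * ?f = 1\<^sub>m (\<rho> + \<rho>)" "?f * ?g = 1\<^sub>m (\<rho> + \<rho>)"
    using mutually_inverse_block[OF P mutually_inverse_sym[OF Q]] by (auto simp: mutually_inverse_def)
  with f g show ?thesis by (auto simp: is_iso_def zmf_def)
qed

section \<open>Normal forms of the block \<open>v\<close> and choice of representatives\<close>

lemma det_nonzero_if_mutually_inverse: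
  fixes P :: "'a::idom mat"
  assumes "mutually_inverse n P P'"
  shows "det P \<noteq> 0"
proof -
  have "det P * det P' = 1"
    using assms det_mult[of P n P'] by (simp add: mutually_inverse_def)
  then show ?thesis by auto
qed

text \<open>Entrywise associates differ by unit factors, which form an invertible diagonal matrix.
  This lets arbitrary representatives of the invariant factors replace the entries of a Smith
  form.\<close>

lemma mat_diag_associated:
  fixes d e :: "nat \<Rightarrow> 'a::idom"
  assumes "\<And>i. i < n \<Longrightarrow> d i dvd e i" "\<And>i. i < n \<Longrightarrow> e i dvd d i"
    and nz: "\<And>i. i < n \<Longrightarrow> e i \<noteq> 0"
  shows "equivalent_mats n (mat_diag n e) (mat_diag n d)"
proof -
  have "\<exists>s t. i < n \<longrightarrow> d i = s * e i \<and> s * t = 1" for i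
  proof (cases "i < n")
    case True
    then obtain s t where s: "d i = e i * s" and t: "e i = d i * t" using assms by (metis dvdE)
    have "e i * (s * t) = e i * 1" using s t by (simp add: mult.assoc[symmetric])
    then have "s * t = 1" using nz[OF True] by (metis mult_left_cancel)
    with s show ?thesis by (auto simp: mult.commute)
  qed auto
  then obtain s t where st: "\<And>i. i < n \<Longrightarrow> d i = s i * e i" "\<And>i. i < n \<Longrightarrow> s i * t i = 1" by metis
  have "mat_diag n (\<lambda>i. s i * t i) = 1\<^sub>m n" "mat_diag n (\<lambda>i. t i * s i) = 1\<^sub>m n"
    using st(2) by (auto simp: mat_diag_def mult.commute intro!: eq_matI)
  then have "mutually_inverse n (mat_diag n s) (mat_diag n t)" by (simp add: mutually_inverse_def)
  moreover have "mat_diag n d = mat_diag n s * mat_diag n e * 1\<^sub>m n"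
  proof -
    have "mat_diag n d = mat_diag n (\<lambda>i. s i * e i)"
      using st(1) by (auto simp: mat_diag_def intro!: eq_matI)
    then show ?thesis by (simp add: right_mult_one_mat[OF mat_diag_dim])
  qed
  ultimately show ?thesis by (rule equivalent_matsI[OF mat_diag_dim _ mutually_inverse_one])
qed

text \<open>The transforming matrices have nonzero determinant, so the product of the diagonal
  entries is nonzero; hence none of them vanishes and each determines its invariant factor up to
  units.\<close>

lemma smith_normal_form_nonsingular:
  fixes v :: "'a::elementary_divisor_domain mat"
  assumes v: "v \<in> carrier_mat n n" and det: "det v \<noteq> 0"
  obtains e where "equivalent_mats n v (mat_diag n e)" "\<And>i. i < n \<Longrightarrow> e i \<noteq> 0"
    "\<And>i. i < n \<Longrightarrow> e i \<in> invariant_factor (Suc i) v"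
    "\<And>i d. i < n \<Longrightarrow> d \<in> invariant_factor (Suc i) v \<Longrightarrow> d dvd e i \<and> e i dvd d"
proof -
  obtain e where eq: "equivalent_mats n v (mat_diag n e)"
    and chain: "\<And>i j. i \<le> j \<Longrightarrow> j < n \<Longrightarrow> e i dvd e j"
    using smith_normal_form[OF v] by blast
  obtain P P' Q Q' where P: "mutually_inverse n P P'" and Q: "mutually_inverse n Q Q'"
    and e: "mat_diag n e = P * v * Q"
    using eq by (auto simp: equivalent_mats_def)
  have c: "P \<in> carrier_mat n n" "Q \<in> carrier_mat n n" using P Q by (auto simp: mutually_inverse_def)
  have "det (mat_diag n e) = det P * det v * det Q"
    unfolding e using det_mult[of "P * v" n Q] det_mult[of P n v] c v by simp
  then have "(\<Prod>i<n. e i) \<noteq> 0"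
    using det det_nonzero_if_mutually_inverse[OF P] det_nonzero_if_mutually_inverse[OF Q]
    by (simp add: det_mat_diag)
  then have nz: "e i \<noteq> 0" if "i < n" for i using that by auto
  note inv = equivalent_mats_invariant_factor[OF eq]
  show ?thesis
    using invariant_factor_mat_diag[where e = e and n = n, OF chain nz]
    by (intro that[of e]) (auto simp: inv eq nz)
qed

text \<open>Taking determinants gives \<open>det v * det u = W ^ n\<close>, which is nonzero in a
  domain.\<close>

lemma det_nonzero_if_mf:
  fixes u v :: "'a::idom mat"
  assumes "W \<noteq> 0" "u \<in> carrier_mat n n" "v \<in> carrier_mat n n" "v * u = W \<cdot>\<^sub>m 1\<^sub>m n"
  shows "det v \<noteq> 0"
proof -
  have "det v * det u = W ^ n" using det_mult[of v n u] assms by simp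
  with assms(1) show ?thesis by auto
qed

text \<open>Guarantees that a claim about all choices of representatives is not vacuous.\<close>

lemma invariant_factor_reps_exists:
  fixes W :: "'a::elementary_divisor_domain"
  assumes "W \<noteq> 0"
  shows "\<exists>d. invariant_factor_reps W d"
proof
  show "invariant_factor_reps W (\<lambda>v i. SOME x. x \<in> invariant_factor i v)"
    unfolding invariant_factor_reps_def
  proof (intro allI ballI impI)
    fix \<rho> i and u v :: "'a mat"
    assume uv: "u \<in> carrier_mat \<rho> \<rho>" "v \<in> carrier_mat \<rho> \<rho>" "(\<rho>, odd_mat \<rho> u v) \<in> Ob (zmf W)"
      and i: "i \<in> {1..\<rho>}"
    have "det v \<noteq> 0" using det_nonzero_if_mf[OF assms uv(1,2)] uv Ob_zmf_odd_mat_iff by blast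
    then obtain e where e: "\<And>i. i < \<rho> \<Longrightarrow> e i \<in> invariant_factor (Suc i) v"
      using smith_normal_form_nonsingular[OF uv(2)] by metis
    obtain k where "i = Suc k" "k < \<rho>" using i by (cases i) auto
    with e[of k] show "(SOME x. x \<in> invariant_factor i v) \<in> invariant_factor i v" by (auto intro: someI)
  qed
qed

lemma zmf_iso_elementary:
  fixes W :: "'a::elementary_divisor_domain"
  assumes W: "W \<noteq> 0" and u: "u \<in> carrier_mat \<rho> \<rho>" and v: "v \<in> carrier_mat \<rho> \<rho>"
    and ob: "(\<rho>, odd_mat \<rho> u v) \<in> Ob (zmf W)"
    and d: "\<And>i. i \<in> {1..\<rho>} \<Longrightarrow> d i \<in> invariant_factor i v"
  defines "T \<equiv> direct_sum_mf (map (\<lambda>i. elementary_mf W (d i)) [1..<Suc \<rho>])"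
  shows "T \<in> Ob (zmf W)" "\<exists>f. is_iso (zmf W) T (\<rho>, odd_mat \<rho> u v) f"
proof -
  have uv: "v * u = W \<cdot>\<^sub>m 1\<^sub>m \<rho>" "u * v = W \<cdot>\<^sub>m 1\<^sub>m \<rho>" using ob Ob_zmf_odd_mat_iff[OF u v] by auto
  obtain e where eq: "equivalent_mats \<rho> v (mat_diag \<rho> e)" and nz: "\<And>i. i < \<rho> \<Longrightarrow> e i \<noteq> 0"
    and e: "\<And>i d. i < \<rho> \<Longrightarrow> d \<in> invariant_factor (Suc i) v \<Longrightarrow> d dvd e i \<and> e i dvd d"
    using smith_normal_form_nonsingular[OF v det_nonzero_if_mf[OF W u v uv(1)]] by metis
  have de: "d (Suc i) dvd e i \<and> e i dvd d (Suc i)" if "i < \<rho>" for i using e[OF that d] that by auto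
  have dnz: "d (Suc i) \<noteq> 0" if "i < \<rho>" for i using de[OF that] nz[OF that] by auto
  have "equivalent_mats \<rho> v (mat_diag \<rho> (\<lambda>i. d (Suc i)))"
    by (rule equivalent_mats_trans[OF eq mat_diag_associated]) (use de nz in auto)
  then obtain P P' Q Q' where P: "mutually_inverse \<rho> P P'" and Q: "mutually_inverse \<rho> Q Q'"
    and PvQ: "mat_diag \<rho> (\<lambda>i. d (Suc i)) = P * v * Q"
    by (auto simp: equivalent_mats_def)
  have c: "P \<in> carrier_mat \<rho> \<rho>" "P' \<in> carrier_mat \<rho> \<rho>" "Q \<in> carrier_mat \<rho> \<rho>" "Q' \<in> carrier_mat \<rho> \<rho>"
    using P Q by (auto simp: mutually_inverse_def)
  let ?u = "Q' * u * P'"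
  have uc: "?u \<in> carrier_mat \<rho> \<rho>" using c u by auto
  \<comment> \<open>The inner pair \<open>Q\<close>, \<open>Q'\<close> cancels, leaving the scalar
    matrix \<open>v * u\<close> conjugated by \<open>P\<close>.\<close>
  have vu: "P * v * Q * ?u = W \<cdot>\<^sub>m 1\<^sub>m \<rho>"
  proof -
    have "Q * ?u = u * P'"
      using mutually_inverse_cancel[OF Q, of "u * P'" \<rho>] assoc_mult_mat[OF c(4) u c(2)] c u by simp
    then have "P * v * Q * ?u = P * v * (u * P')"
      using assoc_mult_mat[of "P * v" \<rho> \<rho> Q \<rho> ?u \<rho>] c v uc by simp
    also have "\<dots> = P * (v * u * P')" using c u v by (simp add: assoc_mult_mat[of _ \<rho> \<rho> _ \<rho> _ \<rho>])
    also have "\<dots> = W \<cdot>\<^sub>m (P * P')"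
      using c unfolding uv by (simp add: mult_smult_assoc_mat[of _ \<rho> \<rho> _ \<rho>] mult_smult_distrib[of _ \<rho> \<rho> _ \<rho>])
    finally show ?thesis using P by (simp add: mutually_inverse_def)
  qed
  have uv': "?u * (P * v * Q) = W \<cdot>\<^sub>m 1\<^sub>m \<rho>"
  proof -
    have "P' * (P * v * Q) = v * Q"
      using mutually_inverse_cancel[OF mutually_inverse_sym[OF P], of "v * Q" \<rho>] assoc_mult_mat[OF c(1) v c(3)] c v
      by simp
    then have "?u * (P * v * Q) = Q' * u * (v * Q)"
      using assoc_mult_mat[of "Q' * u" \<rho> \<rho> P' \<rho> "P * v * Q" \<rho>] c u v by simp
    also have "\<dots> = Q' * (u * v * Q)" using c u v by (simp add: assoc_mult_mat[of _ \<rho> \<rho> _ \<rho> _ \<rho>])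
    also have "\<dots> = W \<cdot>\<^sub>m (Q' * Q)"
      using c unfolding uv by (simp add: mult_smult_assoc_mat[of _ \<rho> \<rho> _ \<rho>] mult_smult_distrib[of _ \<rho> \<rho> _ \<rho>])
    finally show ?thesis using Q by (simp add: mutually_inverse_def)
  qed
  \<comment> \<open>The diagonal matrix of the representatives times \<open>?u\<close> is
    \<open>W\<close> times the identity. Cancelling the nonzero \<open>d (Suc i)\<close> row by row
    forces \<open>?u\<close> to be diagonal with the quotients of \<open>W\<close>, and also gives
    the uniqueness behind \<open>THE\<close>.\<close>
  have u_diag: "?u = mat_diag \<rho> (\<lambda>i. THE w. W = d (Suc i) * w)"
  proof (rule eq_matI)
    fix i j assume "i < dim_row (mat_diag \<rho> (\<lambda>i. THE w. W = d (Suc i) * w))"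
      "j < dim_col (mat_diag \<rho> (\<lambda>i. THE w. W = d (Suc i) * w))"
    then have ij: "i < \<rho>" "j < \<rho>" by (auto simp: mat_diag_def)
    have "(mat_diag \<rho> (\<lambda>i. d (Suc i)) * ?u) $$ (i, j) = (W \<cdot>\<^sub>m 1\<^sub>m \<rho>) $$ (i, j)"
      unfolding PvQ vu ..
    then have *: "d (Suc i) * ?u $$ (i, j) = (if i = j then W else 0)"
      unfolding mat_diag_mult_left[OF uc] using ij by simp
    show "?u $$ (i, j) = mat_diag \<rho> (\<lambda>i. THE w. W = d (Suc i) * w) $$ (i, j)"
    proof (cases "i = j")
      case True
      have "(THE w. W = d (Suc i) * w) = ?u $$ (i, j)"
      proof (rule the_equality)
        show "W = d (Suc i) * ?u $$ (i, j)" using * True by simp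
        show "w = ?u $$ (i, j)" if "W = d (Suc i) * w" for w
          using * True that dnz[OF ij(1)] by (metis mult_left_cancel)
      qed
      with True ij show ?thesis by (simp add: mat_diag_def)
    next
      case False
      with * dnz[OF ij(1)] have "?u $$ (i, j) = 0" by (metis mult_eq_0_iff)
      with False ij show ?thesis by (simp add: mat_diag_def)
    qed
  qed (use uc in \<open>auto simp: mat_diag_def\<close>)
  have T: "T = (\<rho>, odd_mat \<rho> ?u (P * v * Q))"
    unfolding T_def direct_sum_elementary_mf u_diag PvQ[symmetric] ..
  show "T \<in> Ob (zmf W)" unfolding T using uc c v vu uv' by (subst Ob_zmf_odd_mat_iff) auto
  show "\<exists>f. is_iso (zmf W) T (\<rho>, odd_mat \<rho> u v) f" unfolding T using zmf_is_isoI[OF u v P Q] by blast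
qed

section \<open>Construction of the functor\<close>

theorem theorem3p2:
  fixes W :: "'a::elementary_divisor_domain"
  assumes "W \<noteq> 0"
  shows "(\<exists>d. invariant_factor_reps W d) \<and>
    (\<forall>d. invariant_factor_reps W d \<longrightarrow>
      (\<exists>F. autoequivalence (zmf W) F \<and>
         func_isomorphic (zmf W) (zmf W) F id_func \<and>
         (\<forall>\<rho>. \<forall>u\<in>carrier_mat \<rho> \<rho>. \<forall>v\<in>carrier_mat \<rho> \<rho>.
            (\<rho>, odd_mat \<rho> u v) \<in> Ob (zmf W) \<longrightarrow>
            omap F (\<rho>, odd_mat \<rho> u v) =
              direct_sum_mf (map (\<lambda>i. elementary_mf W (d v i)) [1..<Suc \<rho>]))))"
proof (intro conjI allI impI)
  show "\<exists>d. invariant_factor_reps W d" by (rule invariant_factor_reps_exists[OF assms])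
next
  fix d assume d: "invariant_factor_reps W d"
  interpret category "zmf W" by (rule category_zmf)
  \<comment> \<open>\<open>T\<close> has to be a function of the object alone, so \<open>v\<close>
    and the rank are read off from the pair.\<close>
  define T where "T = (\<lambda>a. direct_sum_mf (map (\<lambda>i. elementary_mf W (d (mf_v a) i)) [1..<Suc (fst a)]))"
  have T_odd: "T (\<rho>, odd_mat \<rho> u v) = direct_sum_mf (map (\<lambda>i. elementary_mf W (d v i)) [1..<Suc \<rho>])"
    if "u \<in> carrier_mat \<rho> \<rho>" "v \<in> carrier_mat \<rho> \<rho>" for \<rho> u v
    unfolding T_def mf_blocks_odd_mat[OF that] fst_conv ..
  have "T a \<in> Ob (zmf W) \<and> (\<exists>f. is_iso (zmf W) (T a) a f)" if a: "a \<in> Ob (zmf W)" for a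
  proof -
    from a obtain \<rho> u v where a_eq: "a = (\<rho>, odd_mat \<rho> u v)" and uv: "u \<in> carrier_mat \<rho> \<rho>" "v \<in> carrier_mat \<rho> \<rho>"
      by (rule Ob_zmfE)
    have "d v i \<in> invariant_factor i v" if "i \<in> {1..\<rho>}" for i
      using d a uv that unfolding a_eq invariant_factor_reps_def by blast
    from zmf_iso_elementary[OF assms uv a[unfolded a_eq] this] show ?thesis
      unfolding a_eq T_odd[OF uv] by blast
  qed
  then obtain F where F: "omap F = T" "func_isomorphic (zmf W) (zmf W) F id_func"
    using func_isomorphic_id_if_isos[of T] by blast
  show "\<exists>F. autoequivalence (zmf W) F \<and> func_isomorphic (zmf W) (zmf W) F id_func \<and>
      (\<forall>\<rho>. \<forall>u\<in>carrier_mat \<rho> \<rho>. \<forall>v\<in>carrier_mat \<rho> \<rho>. (\<rho>, odd_mat \<rho> u v) \<in> Ob (zmf W) \<longrightarrow>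
        omap F (\<rho>, odd_mat \<rho> u v) = direct_sum_mf (map (\<lambda>i. elementary_mf W (d v i)) [1..<Suc \<rho>]))"
    using F autoequivalence_if_func_isomorphic_id[OF F(2)] T_odd by (intro exI[of _ F]) simp
qed

end
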